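(* Let $C$ be a smooth irreducible projective curve over $\mathbb{C}$ and $n\geq 3$ an integer. Let $\rho_n:\mathcal{G}_n\to\mathcal{G}_{n-1}$ be the canonical restriction morphism. Then there is an isomorphism of sheaves of groups $\ker(\rho_n)\simeq T_C\oplus\mathcal{O}_C$, where $T_C$ is the tangent bundle of $C$.
   Context: For $m\geq 1$, $\mathcal{A}_m$ is the sheaf of algebras on $C$ defined by $\mathcal{A}_m(U)=\mathcal{O}_C(U)\otimes_{\mathbb{C}}\mathbb{C}[t]/(t^m)$. $\mathcal{G}_m$ is the sheaf of (nonabelian) groups on $C$ such that for every proper open subset $U\subset C$, $\mathcal{G}_m(U)$ is the group of automorphisms of the $\mathbb{C}$-algebra $\mathcal{A}_m(U)$ which commute with the projection $\mathcal{A}_m(U)\to\mathcal{O}_C(U)$, $t\mapsto 0$. Elements of $\mathcal{G}_n(U)$ leave invariant the ideal $(t^{n-1})$, hence induce elements of $\mathcal{G}_{n-1}(U)$; this defines $\rho_n:\mathcal{G}_n\to\mathcal{G}_{n-1}$. *)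

theory Defs
  imports "HOL-Analysis.Analysis" "HOL-Algebra.Module" "HOL-Algebra.QuotRing" "HOL-Algebra.Bij"
begin

section \<open>Projective curves over the complex numbers\<close>

text \<open>
  Varieties are classical: closed subsets of a projective space, consisting of closed points and
  carrying the Zariski topology and the sheaf of regular functions. With homogeneous coordinates
  indexed by the finite type \<open>'k\<close>, the ambient space has dimension \<open>CARD('k) - 1\<close>; its points are
  the lines through the origin.
\<close>

type_synonym 'k pt = "(complex^'k) set"

definition proj_space :: "('k::finite) pt set" where
  "proj_space = {vec.span {v} | v. v \<noteq> 0}"

text \<open>Over an infinite field a homogeneous polynomial may be identified with its function.\<close>

definition homogeneous_form :: "nat \<Rightarrow> (complex^('k::finite) \<Rightarrow> complex) \<Rightarrow> bool" where
  "homogeneous_form d F \<longleftrightarrow>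
     (\<exists>c :: ('k \<Rightarrow> nat) \<Rightarrow> complex.
        F = (\<lambda>v. \<Sum>\<alpha> | (\<Sum>i\<in>UNIV. \<alpha> i) = d. c \<alpha> * (\<Prod>i\<in>UNIV. (v $ i) ^ \<alpha> i)))"

definition nonvanishing_locus :: "(complex^('k::finite) \<Rightarrow> complex) \<Rightarrow> 'k pt set" where
  "nonvanishing_locus F = {p \<in> proj_space. \<forall>v \<in> p - {0}. F v \<noteq> 0}"

definition zariski :: "('k::finite) pt topology" where
  "zariski = topology_generated_by {nonvanishing_locus F | F d. homogeneous_form d F}"

abbreviation zariski_on :: "('k::finite) pt set \<Rightarrow> 'k pt topology" where
  "zariski_on C \<equiv> subtopology zariski C"

definition irreducible_in :: "'a topology \<Rightarrow> 'a set \<Rightarrow> bool" where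
  "irreducible_in T S \<longleftrightarrow> S \<noteq> {} \<and> S \<subseteq> topspace T \<and>
     (\<forall>A B. closedin T A \<and> closedin T B \<and> S \<subseteq> A \<union> B \<longrightarrow> S \<subseteq> A \<or> S \<subseteq> B)"

definition krull_dim :: "'a topology \<Rightarrow> enat" where
  "krull_dim T = Sup {enat k | k. \<exists>Z :: nat \<Rightarrow> 'a set.
     (\<forall>i\<le>k. closedin T (Z i) \<and> irreducible_in T (Z i)) \<and> (\<forall>i<k. Z i \<subset> Z (Suc i))}"

text \<open>
  The common kernel of the differentials at \<open>v\<close> of all homogeneous polynomials vanishing on \<open>C\<close>,
  i.e. the Zariski tangent space at \<open>v\<close> of the affine cone over \<open>C\<close>.
\<close>

definition cone_tangent_space :: "('k::finite) pt set \<Rightarrow> complex^'k \<Rightarrow> (complex^'k) set" where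
  "cone_tangent_space C v =
     {w. \<forall>d F. homogeneous_form d F \<and> (\<forall>p\<in>C. \<forall>u\<in>p - {0}. F u = 0)
           \<longrightarrow> deriv (\<lambda>s. F (v + s *s w)) 0 = 0}"

text \<open>
  Smoothness is the Jacobian criterion. The affine cone over a curve has dimension 2, so the rank of
  the Jacobian matrix has to be \<open>CARD('k) - 2\<close>.
\<close>

locale smooth_irreducible_projective_curve =
  fixes C :: "('k::finite) pt set"
  assumes closed_in_proj_space: "closedin zariski C"
    and irreducible: "irreducible_in zariski C"
    and dimension_one: "krull_dim (zariski_on C) = 1"
    and smooth: "\<forall>p\<in>C. \<forall>v\<in>p - {0}. vec.dim (cone_tangent_space C v) = 2"


section \<open>The sheaf of algebras\<close>

text \<open>
  Regular functions on an open subset \<open>U\<close> of \<open>C\<close>, extensional so that equality of sections is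
  equality of functions.
\<close>

definition regular_functions :: "('k::finite) pt set \<Rightarrow> 'k pt set \<Rightarrow> ('k pt \<Rightarrow> complex) set" where
  "regular_functions C U = {f \<in> extensional U. \<forall>p\<in>U. \<exists>W. openin (zariski_on C) W \<and> p \<in> W \<and> W \<subseteq> U \<and>
     (\<exists>d F G. homogeneous_form d F \<and> homogeneous_form d G \<and>
        (\<forall>q\<in>W. \<forall>v\<in>q - {0}. G v \<noteq> 0 \<and> f q = F v / G v))}"

definition \<O> :: "('k::finite) pt set \<Rightarrow> 'k pt set \<Rightarrow> (complex, 'k pt \<Rightarrow> complex) module" where
  "\<O> C U =
     \<lparr>carrier = regular_functions C U,
      mult = \<lambda>f g. \<lambda>p\<in>U. f p * g p,
      one = \<lambda>p\<in>U. 1,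
      zero = \<lambda>p\<in>U. 0,
      add = \<lambda>f g. \<lambda>p\<in>U. f p + g p,
      smult = \<lambda>c f. \<lambda>p\<in>U. c * f p\<rparr>"

text \<open>
  Since \<open>1, t, \<dots>, t^(m-1)\<close> is a basis of \<open>\<complex>[t]/(t^m)\<close>, an element of \<open>\<O>(U) \<otimes> \<complex>[t]/(t^m)\<close> is a sum
  \<open>\<Sum>i<m. a i t^i\<close> with \<open>a i \<in> \<O>(U)\<close>. It is represented by its coefficient sequence \<open>a\<close>, continued by
  zero.
\<close>

type_synonym 'k coeffs = "nat \<Rightarrow> 'k pt \<Rightarrow> complex"
type_synonym 'k coeff_map = "'k coeffs \<Rightarrow> 'k coeffs"

definition \<A> :: "('k::finite) pt set \<Rightarrow> nat \<Rightarrow> 'k pt set \<Rightarrow> (complex, 'k coeffs) module" where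
  "\<A> C m U =
     \<lparr>carrier = {a. (\<forall>i<m. a i \<in> carrier (\<O> C U)) \<and> (\<forall>i\<ge>m. a i = \<zero>\<^bsub>\<O> C U\<^esub>)},
      mult = \<lambda>a b i. if i < m then (\<lambda>p\<in>U. \<Sum>j\<le>i. a j p * b (i - j) p) else \<zero>\<^bsub>\<O> C U\<^esub>,
      one = \<lambda>i. if i = 0 \<and> i < m then \<one>\<^bsub>\<O> C U\<^esub> else \<zero>\<^bsub>\<O> C U\<^esub>,
      zero = \<lambda>i. \<zero>\<^bsub>\<O> C U\<^esub>,
      add = \<lambda>a b i. a i \<oplus>\<^bsub>\<O> C U\<^esub> b i,
      smult = \<lambda>c a i. c \<odot>\<^bsub>\<O> C U\<^esub> a i\<rparr>"

definition \<A>_restrict :: "'k pt set \<Rightarrow> 'k coeffs \<Rightarrow> 'k coeffs" where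
  "\<A>_restrict V a = (\<lambda>i. restrict (a i) V)"

text \<open>Reduction modulo \<open>t^k\<close>.\<close>

definition \<A>_trunc :: "nat \<Rightarrow> ('k::finite) pt set \<Rightarrow> 'k coeffs \<Rightarrow> 'k coeffs" where
  "\<A>_trunc k U a = (\<lambda>i. if i < k then a i else (\<lambda>p\<in>U. 0))"

text \<open>The projection \<open>t \<mapsto> 0\<close> sends \<open>a\<close> to \<open>a 0\<close>.\<close>

definition Aut_\<A> :: "('k::finite) pt set \<Rightarrow> nat \<Rightarrow> 'k pt set \<Rightarrow> 'k coeff_map monoid" where
  "Aut_\<A> C m U = BijGroup (carrier (\<A> C m U))
     \<lparr>carrier := {\<phi> \<in> Bij (carrier (\<A> C m U)).
        \<phi> \<in> ring_iso (\<A> C m U) (\<A> C m U) \<and>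
        (\<forall>c. \<forall>a \<in> carrier (\<A> C m U). \<phi> (c \<odot>\<^bsub>\<A> C m U\<^esub> a) = c \<odot>\<^bsub>\<A> C m U\<^esub> \<phi> a) \<and>
        (\<forall>a \<in> carrier (\<A> C m U). \<phi> a 0 = a 0)}\<rparr>"


section \<open>Sheaves of groups\<close>

text \<open>\<open>F U\<close> is the group of sections over \<open>U\<close>, and \<open>r U V\<close> the restriction from \<open>U\<close> to \<open>V\<close>.\<close>

locale sheaf_of_groups =
  fixes T :: "'a topology"
    and F :: "'a set \<Rightarrow> ('s, 'm) monoid_scheme"
    and r :: "'a set \<Rightarrow> 'a set \<Rightarrow> 's \<Rightarrow> 's"
  assumes group_sections: "openin T U \<Longrightarrow> group (F U)"
    and restriction_hom: "\<lbrakk>openin T U; openin T V; V \<subseteq> U\<rbrakk> \<Longrightarrow> r U V \<in> hom (F U) (F V)"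
    and restriction_id: "\<lbrakk>openin T U; s \<in> carrier (F U)\<rbrakk> \<Longrightarrow> r U U s = s"
    and restriction_trans: "\<lbrakk>openin T U; openin T V; openin T W; W \<subseteq> V; V \<subseteq> U; s \<in> carrier (F U)\<rbrakk>
      \<Longrightarrow> r V W (r U V s) = r U W s"
    and gluing: "\<lbrakk>\<forall>V\<in>\<U>. openin T V; \<forall>V\<in>\<U>. \<sigma> V \<in> carrier (F V);
        \<forall>V\<in>\<U>. \<forall>W\<in>\<U>. r V (V \<inter> W) (\<sigma> V) = r W (V \<inter> W) (\<sigma> W)\<rbrakk>
      \<Longrightarrow> \<exists>!s. s \<in> carrier (F (\<Union>\<U>)) \<and> (\<forall>V\<in>\<U>. r (\<Union>\<U>) V s = \<sigma> V)"

definition sheaf_hom :: "'a topology \<Rightarrow> ('a set \<Rightarrow> ('s, 'm) monoid_scheme) \<Rightarrow> ('a set \<Rightarrow> 'a set \<Rightarrow> 's \<Rightarrow> 's)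
    \<Rightarrow> ('a set \<Rightarrow> ('t, 'n) monoid_scheme) \<Rightarrow> ('a set \<Rightarrow> 'a set \<Rightarrow> 't \<Rightarrow> 't) \<Rightarrow> ('a set \<Rightarrow> 's \<Rightarrow> 't) \<Rightarrow> bool" where
  "sheaf_hom T F r F' r' \<theta> \<longleftrightarrow>
     (\<forall>U. openin T U \<longrightarrow> \<theta> U \<in> hom (F U) (F' U)) \<and>
     (\<forall>U V. openin T U \<and> openin T V \<and> V \<subseteq> U \<longrightarrow>
        (\<forall>s \<in> carrier (F U). \<theta> V (r U V s) = r' U V (\<theta> U s)))"

definition sheaves_isomorphic :: "'a topology \<Rightarrow> ('a set \<Rightarrow> ('s, 'm) monoid_scheme) \<Rightarrow> ('a set \<Rightarrow> 'a set \<Rightarrow> 's \<Rightarrow> 's)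
    \<Rightarrow> ('a set \<Rightarrow> ('t, 'n) monoid_scheme) \<Rightarrow> ('a set \<Rightarrow> 'a set \<Rightarrow> 't \<Rightarrow> 't) \<Rightarrow> bool" where
  "sheaves_isomorphic T F r F' r' \<longleftrightarrow>
     sheaf_of_groups T F r \<and> sheaf_of_groups T F' r' \<and>
     (\<exists>\<theta>. sheaf_hom T F r F' r' \<theta> \<and> (\<forall>U. openin T U \<longrightarrow> \<theta> U \<in> iso (F U) (F' U)))"

text \<open>The restrictions of the kernel are those of \<open>F\<close>.\<close>

definition kernel_sheaf :: "('a set \<Rightarrow> ('s, 'm) monoid_scheme) \<Rightarrow> ('a set \<Rightarrow> ('t, 'n) monoid_scheme)
    \<Rightarrow> ('a set \<Rightarrow> 's \<Rightarrow> 't) \<Rightarrow> 'a set \<Rightarrow> ('s, 'm) monoid_scheme" where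
  "kernel_sheaf F F' \<theta> U = (F U)\<lparr>carrier := kernel (F U) (F' U) (\<theta> U)\<rparr>"


section \<open>The sheaves of automorphisms\<close>

text \<open>
  The sheaf of groups whose group of sections over each proper open subset \<open>U\<close> of \<open>C\<close> is
  \<open>Aut_\<A> C m U\<close>, with the restrictions induced by those of \<open>\<A> C m\<close>. These restrictions exist because
  proper open subsets of a projective curve are affine. The sections over \<open>C\<close> itself are determined, up to unique isomorphism, by the gluing condition (\<open>C\<close> is a union of proper open
  subsets), and not by the automorphisms of \<open>\<A> C m C\<close>; the type of sections is large enough to
  accommodate them.
\<close>

locale aut_sheaf = sheaf_of_groups "zariski_on C" G r
  for C :: "('k::finite) pt set" and m :: nat
    and G :: "'k pt set \<Rightarrow> 'k coeff_map monoid"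
    and r +
  assumes sections: "\<lbrakk>openin (zariski_on C) U; U \<noteq> C\<rbrakk> \<Longrightarrow> G U = Aut_\<A> C m U"
    and restriction: "\<lbrakk>openin (zariski_on C) U; U \<noteq> C; openin (zariski_on C) V; V \<subseteq> U;
        \<phi> \<in> carrier (G U); a \<in> carrier (\<A> C m U)\<rbrakk>
      \<Longrightarrow> r U V \<phi> (\<A>_restrict V a) = \<A>_restrict V (\<phi> a)"

text \<open>
  The morphism of sheaves for which, over proper open subsets, an automorphism is sent to the one it
  induces modulo \<open>t^(n-1)\<close>.
\<close>

definition canonical_morphism :: "('k::finite) pt set \<Rightarrow> nat
    \<Rightarrow> ('k pt set \<Rightarrow> 'k coeff_map monoid) \<Rightarrow> ('k pt set \<Rightarrow> 'k pt set \<Rightarrow> 'k coeff_map \<Rightarrow> 'k coeff_map)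
    \<Rightarrow> ('k pt set \<Rightarrow> 'k coeff_map monoid) \<Rightarrow> ('k pt set \<Rightarrow> 'k pt set \<Rightarrow> 'k coeff_map \<Rightarrow> 'k coeff_map)
    \<Rightarrow> ('k pt set \<Rightarrow> 'k coeff_map \<Rightarrow> 'k coeff_map) \<Rightarrow> bool" where
  "canonical_morphism C n G r G' r' \<rho> \<longleftrightarrow>
     sheaf_hom (zariski_on C) G r G' r' \<rho> \<and>
     (\<forall>U. openin (zariski_on C) U \<and> U \<noteq> C \<longrightarrow>
        (\<forall>\<phi> \<in> carrier (G U). \<forall>a \<in> carrier (\<A> C n U).
           \<rho> U \<phi> (\<A>_trunc (n - 1) U a) = \<A>_trunc (n - 1) U (\<phi> a)))"


section \<open>The tangent sheaf\<close>

definition derivations :: "('k::finite) pt set \<Rightarrow> 'k pt set \<Rightarrow> (('k pt \<Rightarrow> complex) \<Rightarrow> ('k pt \<Rightarrow> complex)) set" where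
  "derivations C U = {D \<in> carrier (\<O> C U) \<rightarrow>\<^sub>E carrier (\<O> C U).
     (\<forall>f \<in> carrier (\<O> C U). \<forall>g \<in> carrier (\<O> C U). D (f \<oplus>\<^bsub>\<O> C U\<^esub> g) = D f \<oplus>\<^bsub>\<O> C U\<^esub> D g) \<and>
     (\<forall>c. \<forall>f \<in> carrier (\<O> C U). D (c \<odot>\<^bsub>\<O> C U\<^esub> f) = c \<odot>\<^bsub>\<O> C U\<^esub> D f) \<and>
     (\<forall>f \<in> carrier (\<O> C U). \<forall>g \<in> carrier (\<O> C U).
        D (f \<otimes>\<^bsub>\<O> C U\<^esub> g) = (f \<otimes>\<^bsub>\<O> C U\<^esub> D g) \<oplus>\<^bsub>\<O> C U\<^esub> (g \<otimes>\<^bsub>\<O> C U\<^esub> D f))}"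

text \<open>
  The sheaf \<open>Der(\<O>, \<O>)\<close> of derivations of the structure sheaf over \<open>\<complex>\<close>, i.e. the dual of the sheaf of
  differentials. A section over \<open>U\<close> is a derivation of the sheaf \<open>\<O>\<close> restricted to \<open>U\<close>, that is a
  family of derivations \<open>D V\<close> of \<open>\<O>(V)\<close>, for \<open>V \<subseteq> U\<close> open, commuting with restriction.
\<close>

definition tangent_sheaf :: "('k::finite) pt set \<Rightarrow> 'k pt set
    \<Rightarrow> ('k pt set \<Rightarrow> ('k pt \<Rightarrow> complex) \<Rightarrow> ('k pt \<Rightarrow> complex)) monoid" where
  "tangent_sheaf C U =
     \<lparr>carrier = {D \<in> (\<Pi>\<^sub>E V \<in> {V. openin (zariski_on C) V \<and> V \<subseteq> U}. derivations C V).
        \<forall>V W. openin (zariski_on C) V \<and> openin (zariski_on C) W \<and> W \<subseteq> V \<and> V \<subseteq> U \<longrightarrow>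
          (\<forall>f \<in> carrier (\<O> C V). D W (restrict f W) = restrict (D V f) W)},
      mult = \<lambda>D E. \<lambda>V \<in> {V. openin (zariski_on C) V \<and> V \<subseteq> U}. \<lambda>f \<in> carrier (\<O> C V).
               D V f \<oplus>\<^bsub>\<O> C V\<^esub> E V f,
      one = \<lambda>V \<in> {V. openin (zariski_on C) V \<and> V \<subseteq> U}. \<lambda>f \<in> carrier (\<O> C V). \<zero>\<^bsub>\<O> C V\<^esub>\<rparr>"

definition tangent_plus_structure_sheaf :: "('k::finite) pt set \<Rightarrow> 'k pt set
    \<Rightarrow> (('k pt set \<Rightarrow> ('k pt \<Rightarrow> complex) \<Rightarrow> ('k pt \<Rightarrow> complex)) \<times> ('k pt \<Rightarrow> complex)) monoid" where
  "tangent_plus_structure_sheaf C U = tangent_sheaf C U \<times>\<times> add_monoid (\<O> C U)"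

definition tangent_plus_structure_restrict :: "('k::finite) pt set \<Rightarrow> 'k pt set \<Rightarrow> 'k pt set
    \<Rightarrow> ('k pt set \<Rightarrow> ('k pt \<Rightarrow> complex) \<Rightarrow> ('k pt \<Rightarrow> complex)) \<times> ('k pt \<Rightarrow> complex)
    \<Rightarrow> ('k pt set \<Rightarrow> ('k pt \<Rightarrow> complex) \<Rightarrow> ('k pt \<Rightarrow> complex)) \<times> ('k pt \<Rightarrow> complex)" where
  "tangent_plus_structure_restrict C U V =
     (\<lambda>(D, f). (restrict D {W. openin (zariski_on C) W \<and> W \<subseteq> V}, restrict f V))"

end

theory Submission
  imports Defs
begin

text \<open>
  Put \<open>N = n - 1\<close>. Over a proper open set \<open>U\<close>, an automorphism in the kernel has the form
  \<open>a \<mapsto> a + t^N \<delta>(a)\<close> for a map \<open>\<delta>\<close> from \<open>\<A>(U)\<close> to \<open>\<O>(U)\<close>. As \<open>t^N\<close> kills the ideal \<open>(t)\<close>,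
  multiplicativity means \<open>\<delta>(a b) = a\<^sub>0 \<delta>(b) + b\<^sub>0 \<delta>(a)\<close>. Hence \<open>\<delta>\<close> vanishes on products of two elements of
  \<open>(t)\<close>, and \<open>\<delta>(a) = D(a\<^sub>0) + a\<^sub>1 g\<close>, where \<open>D\<close> is the derivation of \<open>\<O>(U)\<close> obtained by restricting \<open>\<delta>\<close> to
  constants in \<open>t\<close>, and \<open>g = \<delta>(t)\<close> (\<open>top_order_formula\<close>, \<open>top_order_derivation\<close>). Conversely every pair
  \<open>(D, g)\<close> defines such an automorphism (\<open>top_order_map_in\<close>). Since \<open>N \<ge> 2\<close>, elements of the kernel change
  neither \<open>a\<^sub>0\<close> nor \<open>a\<^sub>1\<close>, so composing them adds the pairs (\<open>top_order_compose\<close>).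

  This compares the kernel with pairs of a derivation of the single ring \<open>\<O>(U)\<close> and a function, whereas
  a section of the tangent sheaf is a compatible family of derivations, one for each open subset of
  \<open>U\<close>. In one direction the family comes from the restrictions of the automorphism. In the other
  direction, let \<open>V\<close> be contained in an affine chart \<open>v\<^sub>i \<noteq> 0\<close> of the projective space. Every regular function on an
  open subset of \<open>V\<close> is locally a quotient of regular functions on \<open>V\<close>
  (\<open>regular_function_local_fraction\<close>), so by the quotient rule the family is determined by its
  member over \<open>V\<close> (\<open>tangent_section_determined_on_chart\<close>). This makes the kernel and
  \<open>T\<^sub>C \<oplus> \<O>\<^sub>C\<close> isomorphic over all proper open sets lying in a chart. These form a basis of the topology, because
  a curve has at least two points, and both sides are sheaves, so the isomorphism extends by gluing to all open sets,
  including \<open>C\<close> (\<open>sheaves_isomorphic_if_iso_on_basis\<close>).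
\<close>

section \<open>Sheaves of groups\<close>

context sheaf_of_groups
begin

lemma section_eqI:
  assumes "\<And>V. V \<in> \<U> \<Longrightarrow> openin T V"
    and s: "s \<in> carrier (F (\<Union>\<U>))" and s': "s' \<in> carrier (F (\<Union>\<U>))"
    and eq: "\<And>V. V \<in> \<U> \<Longrightarrow> r (\<Union>\<U>) V s = r (\<Union>\<U>) V s'"
  shows "s = s'"
proof -
  have op: "openin T (\<Union>\<U>)"
    using assms(1) by blast
  have car: "r (\<Union>\<U>) V s \<in> carrier (F V)" if "V \<in> \<U>" for V
    using restriction_hom[OF op assms(1)[OF that]] that s by (auto simp: hom_def)
  have "\<exists>!u. u \<in> carrier (F (\<Union>\<U>)) \<and> (\<forall>V\<in>\<U>. r (\<Union>\<U>) V u = r (\<Union>\<U>) V s)"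
  proof (rule gluing)
    show "\<forall>V\<in>\<U>. \<forall>W\<in>\<U>. r V (V \<inter> W) (r (\<Union>\<U>) V s) = r W (V \<inter> W) (r (\<Union>\<U>) W s)"
    proof (intro ballI)
      fix V W assume "V \<in> \<U>" "W \<in> \<U>"
      then show "r V (V \<inter> W) (r (\<Union>\<U>) V s) = r W (V \<inter> W) (r (\<Union>\<U>) W s)"
        using assms(1) op s
        by (subst (1 2) restriction_trans) auto
    qed
  qed (use assms car in auto)
  then show ?thesis
    using s s' eq by metis
qed

lemma glue:
  assumes "\<And>V. V \<in> \<U> \<Longrightarrow> openin T V"
    and "\<And>V. V \<in> \<U> \<Longrightarrow> \<sigma> V \<in> carrier (F V)"
    and "\<And>V W. V \<in> \<U> \<Longrightarrow> W \<in> \<U> \<Longrightarrow> r V (V \<inter> W) (\<sigma> V) = r W (V \<inter> W) (\<sigma> W)"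
  shows "\<exists>s \<in> carrier (F (\<Union>\<U>)). \<forall>V\<in>\<U>. r (\<Union>\<U>) V s = \<sigma> V"
  using gluing[of \<U> \<sigma>] assms by blast

lemma restriction_closed:
  "\<lbrakk>openin T U; openin T V; V \<subseteq> U; s \<in> carrier (F U)\<rbrakk> \<Longrightarrow> r U V s \<in> carrier (F V)"
  using restriction_hom by (auto simp: hom_def)

lemma restriction_mult:
  "\<lbrakk>openin T U; openin T V; V \<subseteq> U; s \<in> carrier (F U); s' \<in> carrier (F U)\<rbrakk>
    \<Longrightarrow> r U V (s \<otimes>\<^bsub>F U\<^esub> s') = r U V s \<otimes>\<^bsub>F V\<^esub> r U V s'"
  using restriction_hom by (auto simp: hom_def)

lemma restriction_one:
  "\<lbrakk>openin T U; openin T V; V \<subseteq> U\<rbrakk> \<Longrightarrow> r U V \<one>\<^bsub>F U\<^esub> = \<one>\<^bsub>F V\<^esub>"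
  using restriction_hom[of U V] group_sections by (simp add: hom_one)

lemma mult_closed:
  "\<lbrakk>openin T U; s \<in> carrier (F U); s' \<in> carrier (F U)\<rbrakk> \<Longrightarrow> s \<otimes>\<^bsub>F U\<^esub> s' \<in> carrier (F U)"
  using group_sections[of U] by (simp add: group.is_monoid monoid.m_closed)

end

text \<open>
  A section glued from elements of the kernel is again in the kernel: its image is locally trivial,
  hence trivial by uniqueness of gluing in the target.
\<close>

lemma kernel_sheaf_is_sheaf:
  assumes "sheaf_of_groups T F r" "sheaf_of_groups T F' r'" and hom: "sheaf_hom T F r F' r' \<theta>"
  shows "sheaf_of_groups T (kernel_sheaf F F' \<theta>) r"
proof -
  interpret F: sheaf_of_groups T F r by fact
  interpret F': sheaf_of_groups T F' r' by fact
  have gh: "group_hom (F U) (F' U) (\<theta> U)" if "openin T U" for U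
    using that hom F.group_sections F'.group_sections
    by (auto simp: sheaf_hom_def group_hom_def group_hom_axioms_def)
  have nat: "\<theta> V (r U V s) = r' U V (\<theta> U s)"
    if "openin T U" "openin T V" "V \<subseteq> U" "s \<in> carrier (F U)" for U V s
    using hom that by (auto simp: sheaf_hom_def)
  show ?thesis
  proof (rule sheaf_of_groups.intro)
    fix U assume U: "openin T U"
    show "group (kernel_sheaf F F' \<theta> U)"
      unfolding kernel_sheaf_def
      by (rule subgroup.subgroup_is_group[OF group_hom.subgroup_kernel[OF gh[OF U]] F.group_sections[OF U]])
  next
    fix U V assume UV: "openin T U" "openin T V" "V \<subseteq> U"
    show "r U V \<in> hom (kernel_sheaf F F' \<theta> U) (kernel_sheaf F F' \<theta> V)"
      using UV by (auto simp: hom_def kernel_sheaf_def kernel_def nat F.restriction_closed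
          F.restriction_mult F'.restriction_one)
  next
    fix U s assume "openin T U" "s \<in> carrier (kernel_sheaf F F' \<theta> U)"
    then show "r U U s = s"
      by (simp add: kernel_sheaf_def kernel_def F.restriction_id)
  next
    fix U V W s
    assume "openin T U" "openin T V" "openin T W" "W \<subseteq> V" "V \<subseteq> U"
      and "s \<in> carrier (kernel_sheaf F F' \<theta> U)"
    then show "r V W (r U V s) = r U W s"
      by (simp add: kernel_sheaf_def kernel_def F.restriction_trans)
  next
    fix \<U> \<sigma>
    assume op: "\<forall>V\<in>\<U>. openin T V" and \<sigma>: "\<forall>V\<in>\<U>. \<sigma> V \<in> carrier (kernel_sheaf F F' \<theta> V)"
      and compat: "\<forall>V\<in>\<U>. \<forall>W\<in>\<U>. r V (V \<inter> W) (\<sigma> V) = r W (V \<inter> W) (\<sigma> W)"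
    have opU: "openin T (\<Union>\<U>)"
      using op by blast
    have "\<exists>s \<in> carrier (F (\<Union>\<U>)). \<forall>V\<in>\<U>. r (\<Union>\<U>) V s = \<sigma> V"
      by (rule F.glue) (use op \<sigma> compat in \<open>auto simp: kernel_sheaf_def kernel_def\<close>)
    then obtain s where s: "s \<in> carrier (F (\<Union>\<U>))" "\<And>V. V \<in> \<U> \<Longrightarrow> r (\<Union>\<U>) V s = \<sigma> V"
      by blast
    have "\<theta> (\<Union>\<U>) s = \<one>\<^bsub>F' (\<Union>\<U>)\<^esub>"
    proof (rule F'.section_eqI)
      show "\<theta> (\<Union>\<U>) s \<in> carrier (F' (\<Union>\<U>))"
        using gh[OF opU] s by (simp add: group_hom.hom_closed)
      show "\<one>\<^bsub>F' (\<Union>\<U>)\<^esub> \<in> carrier (F' (\<Union>\<U>))"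
        using F'.group_sections[OF opU] by (simp add: group.is_monoid monoid.one_closed)
      fix V assume V: "V \<in> \<U>"
      then have "r' (\<Union>\<U>) V (\<theta> (\<Union>\<U>) s) = \<theta> V (\<sigma> V)"
        using nat[of "\<Union>\<U>" V s] s op opU by (metis Union_upper)
      also have "\<dots> = \<one>\<^bsub>F' V\<^esub>"
        using \<sigma> V by (auto simp: kernel_sheaf_def kernel_def)
      finally show "r' (\<Union>\<U>) V (\<theta> (\<Union>\<U>) s) = r' (\<Union>\<U>) V \<one>\<^bsub>F' (\<Union>\<U>)\<^esub>"
        using F'.restriction_one[of "\<Union>\<U>" V] V op opU by (simp add: Union_upper)
    qed (use op in auto)
    then have "s \<in> carrier (kernel_sheaf F F' \<theta> (\<Union>\<U>)) \<and> (\<forall>V\<in>\<U>. r (\<Union>\<U>) V s = \<sigma> V)"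
      using s by (simp add: kernel_sheaf_def kernel_def)
    moreover have "u = s"
      if "u \<in> carrier (kernel_sheaf F F' \<theta> (\<Union>\<U>)) \<and> (\<forall>V\<in>\<U>. r (\<Union>\<U>) V u = \<sigma> V)" for u
      using that op s by (intro F.section_eqI[of \<U> u s]) (simp_all add: kernel_sheaf_def kernel_def)
    ultimately show "\<exists>!s. s \<in> carrier (kernel_sheaf F F' \<theta> (\<Union>\<U>)) \<and> (\<forall>V\<in>\<U>. r (\<Union>\<U>) V s = \<sigma> V)"
      by (rule ex1I)
  qed
qed

lemma product_sheaf_is_sheaf:
  assumes "sheaf_of_groups T F r" "sheaf_of_groups T F' r'"
  shows "sheaf_of_groups T (\<lambda>U. F U \<times>\<times> F' U) (\<lambda>U V (s, t). (r U V s, r' U V t))"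
proof -
  interpret F: sheaf_of_groups T F r by fact
  interpret F': sheaf_of_groups T F' r' by fact
  show ?thesis
  proof (rule sheaf_of_groups.intro)
    fix \<U> and \<sigma> :: "'a set \<Rightarrow> 'b \<times> 'd"
    assume op: "\<forall>V\<in>\<U>. openin T V" and \<sigma>: "\<forall>V\<in>\<U>. \<sigma> V \<in> carrier (F V \<times>\<times> F' V)"
      and compat: "\<forall>V\<in>\<U>. \<forall>W\<in>\<U>. (case \<sigma> V of (s, t) \<Rightarrow> (r V (V \<inter> W) s, r' V (V \<inter> W) t))
        = (case \<sigma> W of (s, t) \<Rightarrow> (r W (V \<inter> W) s, r' W (V \<inter> W) t))"
    have \<sigma>': "fst (\<sigma> V) \<in> carrier (F V)" "snd (\<sigma> V) \<in> carrier (F' V)" if "V \<in> \<U>" for V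
      using \<sigma> that by (auto simp: mem_Times_iff)
    have compat': "r V (V \<inter> W) (fst (\<sigma> V)) = r W (V \<inter> W) (fst (\<sigma> W))"
      "r' V (V \<inter> W) (snd (\<sigma> V)) = r' W (V \<inter> W) (snd (\<sigma> W))" if "V \<in> \<U>" "W \<in> \<U>" for V W
      using compat that by (auto simp: case_prod_unfold)
    have "\<exists>s \<in> carrier (F (\<Union>\<U>)). \<forall>V\<in>\<U>. r (\<Union>\<U>) V s = fst (\<sigma> V)"
      by (rule F.glue) (use op \<sigma>' compat' in auto)
    then obtain s where s: "s \<in> carrier (F (\<Union>\<U>))" "\<And>V. V \<in> \<U> \<Longrightarrow> r (\<Union>\<U>) V s = fst (\<sigma> V)"
      by blast
    have "\<exists>t \<in> carrier (F' (\<Union>\<U>)). \<forall>V\<in>\<U>. r' (\<Union>\<U>) V t = snd (\<sigma> V)"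
      by (rule F'.glue) (use op \<sigma>' compat' in auto)
    then obtain t where t: "t \<in> carrier (F' (\<Union>\<U>))" "\<And>V. V \<in> \<U> \<Longrightarrow> r' (\<Union>\<U>) V t = snd (\<sigma> V)"
      by blast
    have uniq: "u = s" if "u \<in> carrier (F (\<Union>\<U>))" "\<forall>V\<in>\<U>. r (\<Union>\<U>) V u = fst (\<sigma> V)" for u
      using F.section_eqI[of \<U> u s] op that s by auto
    have uniq': "u = t" if "u \<in> carrier (F' (\<Union>\<U>))" "\<forall>V\<in>\<U>. r' (\<Union>\<U>) V u = snd (\<sigma> V)" for u
      using F'.section_eqI[of \<U> u t] op that t by auto
    show "\<exists>!u. u \<in> carrier (F (\<Union>\<U>) \<times>\<times> F' (\<Union>\<U>)) \<and>
        (\<forall>V\<in>\<U>. (case u of (s, t) \<Rightarrow> (r (\<Union>\<U>) V s, r' (\<Union>\<U>) V t)) = \<sigma> V)"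
    proof (rule ex1I[of _ "(s, t)"])
      fix u assume u: "u \<in> carrier (F (\<Union>\<U>) \<times>\<times> F' (\<Union>\<U>)) \<and>
        (\<forall>V\<in>\<U>. (case u of (s, t) \<Rightarrow> (r (\<Union>\<U>) V s, r' (\<Union>\<U>) V t)) = \<sigma> V)"
      obtain s' t' where u_eq: "u = (s', t')"
        by (cases u)
      have "(r (\<Union>\<U>) V s', r' (\<Union>\<U>) V t') = \<sigma> V" if "V \<in> \<U>" for V
        using u u_eq that by simp
      then have "r (\<Union>\<U>) V s' = fst (\<sigma> V)" "r' (\<Union>\<U>) V t' = snd (\<sigma> V)" if "V \<in> \<U>" for V
        using that by (metis fst_conv, metis snd_conv)
      then show "u = (s, t)"
        using uniq[of s'] uniq'[of t'] u u_eq by simp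
    qed (simp add: s t)
  qed (auto simp: DirProd_group F.group_sections F'.group_sections hom_def
      F.restriction_closed F.restriction_mult F'.restriction_closed F'.restriction_mult
      F.restriction_id F'.restriction_id F.restriction_trans F'.restriction_trans)
qed

text \<open>
  A sheaf is determined by its sections over a basis: over an arbitrary open set, both the images of
  sections and their preimages are obtained by gluing.
\<close>

lemma sheaves_isomorphic_if_iso_on_basis:
  assumes F_sheaf: "sheaf_of_groups T F r" and F'_sheaf: "sheaf_of_groups T F' r'"
    and opB: "\<And>V. V \<in> B \<Longrightarrow> openin T V"
    and down: "\<And>V W. V \<in> B \<Longrightarrow> openin T W \<Longrightarrow> W \<subseteq> V \<Longrightarrow> W \<in> B"
    and cover: "\<And>x. x \<in> topspace T \<Longrightarrow> \<exists>V\<in>B. x \<in> V"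
    and iso: "\<And>V. V \<in> B \<Longrightarrow> \<theta> V \<in> iso (F V) (F' V)"
    and nat: "\<And>V W s. V \<in> B \<Longrightarrow> openin T W \<Longrightarrow> W \<subseteq> V \<Longrightarrow> s \<in> carrier (F V)
      \<Longrightarrow> \<theta> W (r V W s) = r' V W (\<theta> V s)"
  shows "sheaves_isomorphic T F r F' r'"
proof -
  interpret F: sheaf_of_groups T F r by fact
  interpret F': sheaf_of_groups T F' r' by fact
  define cov where "cov U = {V \<in> B. V \<subseteq> U}" for U
  have Un: "\<Union>(cov U) = U" if U: "openin T U" for U
  proof
    show "U \<subseteq> \<Union>(cov U)"
    proof
      fix x assume x: "x \<in> U"
      then obtain V where V: "V \<in> B" "x \<in> V"
        using cover openin_subset[OF U] by blast
      then have "U \<inter> V \<in> B"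
        using down[of V "U \<inter> V"] U opB by auto
      then show "x \<in> \<Union>(cov U)"
        using x V by (auto simp: cov_def)
    qed
  qed (auto simp: cov_def)
  have opc: "openin T V" "V \<subseteq> U" "V \<in> B" if "V \<in> cov U" for U V
    using that opB by (auto simp: cov_def)
  have \<theta>_closed: "\<theta> V s \<in> carrier (F' V)" if "V \<in> B" "s \<in> carrier (F V)" for V s
    using iso[OF that(1)] that by (auto simp: iso_def hom_def)
  have \<theta>_mult: "\<theta> V (s \<otimes>\<^bsub>F V\<^esub> s') = \<theta> V s \<otimes>\<^bsub>F' V\<^esub> \<theta> V s'"
    if "V \<in> B" "s \<in> carrier (F V)" "s' \<in> carrier (F V)" for V s s'
    using iso[OF that(1)] that by (auto simp: iso_def hom_def)
  have \<theta>_inj: "s = s'" if "V \<in> B" "s \<in> carrier (F V)" "s' \<in> carrier (F V)" "\<theta> V s = \<theta> V s'" for V s s'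
    using iso[OF that(1)] that by (auto simp: iso_def bij_betw_def inj_on_def)
  have \<theta>_surj: "\<exists>s \<in> carrier (F V). \<theta> V s = t" if "V \<in> B" "t \<in> carrier (F' V)" for V t
  proof -
    have "\<theta> V ` carrier (F V) = carrier (F' V)"
      using iso[OF that(1)] by (simp add: iso_def bij_betw_def)
    then have "t \<in> \<theta> V ` carrier (F V)"
      using that(2) by simp
    then show ?thesis
      by auto
  qed
  have F_eqI: "s = s'" if "openin T U" "s \<in> carrier (F U)" "s' \<in> carrier (F U)"
    "\<And>V. V \<in> cov U \<Longrightarrow> r U V s = r U V s'" for U s s'
    using F.section_eqI[of "cov U" s s'] Un[OF that(1)] that opc by auto
  have F'_eqI: "s = s'" if "openin T U" "s \<in> carrier (F' U)" "s' \<in> carrier (F' U)"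
    "\<And>V. V \<in> cov U \<Longrightarrow> r' U V s = r' U V s'" for U s s'
    using F'.section_eqI[of "cov U" s s'] Un[OF that(1)] that opc by auto
  have ex: "\<exists>t. t \<in> carrier (F' U) \<and> (\<forall>V\<in>cov U. r' U V t = \<theta> V (r U V s))"
    if U: "openin T U" and s: "s \<in> carrier (F U)" for U s
  proof -
    have "\<theta> (V \<inter> W) (r U (V \<inter> W) s) = r' V (V \<inter> W) (\<theta> V (r U V s))"
      if "V \<in> cov U" "W \<in> cov U" for V W
    proof -
      have "openin T (V \<inter> W)" "V \<inter> W \<subseteq> V" "V \<inter> W \<subseteq> U"
        using that opc by blast+
      then show ?thesis
        using nat[of V "V \<inter> W" "r U V s"] that opc[of V U] U s
        by (simp add: F.restriction_closed F.restriction_trans)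
    qed
    note * = this
    have "r' V (V \<inter> W) (\<theta> V (r U V s)) = r' W (V \<inter> W) (\<theta> W (r U W s))"
      if "V \<in> cov U" "W \<in> cov U" for V W
      using *[OF that] *[OF that(2) that(1)] by (simp add: Int_commute)
    then have "\<exists>t \<in> carrier (F' (\<Union>(cov U))). \<forall>V\<in>cov U. r' (\<Union>(cov U)) V t = \<theta> V (r U V s)"
      using opc[of _ U] U s by (intro F'.glue) (auto simp: \<theta>_closed F.restriction_closed)
    then show ?thesis
      using Un[OF U] by auto
  qed
  define \<Theta> where "\<Theta> U s = (SOME t. t \<in> carrier (F' U) \<and> (\<forall>V\<in>cov U. r' U V t = \<theta> V (r U V s)))"
    for U s
  have \<Theta>: "\<Theta> U s \<in> carrier (F' U)" "\<And>V. V \<in> cov U \<Longrightarrow> r' U V (\<Theta> U s) = \<theta> V (r U V s)"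
    if "openin T U" "s \<in> carrier (F U)" for U s
    using someI_ex[OF ex[OF that]] unfolding \<Theta>_def by auto
  have hom: "\<Theta> U \<in> hom (F U) (F' U)" if U: "openin T U" for U
  proof (rule homI)
    fix s s' assume s: "s \<in> carrier (F U)" "s' \<in> carrier (F U)"
    show "\<Theta> U (s \<otimes>\<^bsub>F U\<^esub> s') = \<Theta> U s \<otimes>\<^bsub>F' U\<^esub> \<Theta> U s'"
    proof (rule F'_eqI[OF U])
      fix V assume V: "V \<in> cov U"
      show "r' U V (\<Theta> U (s \<otimes>\<^bsub>F U\<^esub> s')) = r' U V (\<Theta> U s \<otimes>\<^bsub>F' U\<^esub> \<Theta> U s')"
        using U s V opc[OF V]
        by (simp add: \<Theta> F.mult_closed F.restriction_mult F'.restriction_mult \<theta>_mult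
          F.restriction_closed)
    qed (use U s in \<open>simp_all add: \<Theta> F.mult_closed F'.mult_closed\<close>)
  qed (use \<Theta> U in auto)
  have nat\<Theta>: "\<Theta> V (r U V s) = r' U V (\<Theta> U s)"
    if UV: "openin T U" "openin T V" "V \<subseteq> U" and s: "s \<in> carrier (F U)" for U V s
  proof (rule F'_eqI[OF UV(2)])
    fix W assume W: "W \<in> cov V"
    then have "W \<in> cov U"
      using UV by (auto simp: cov_def)
    with W show "r' V W (\<Theta> V (r U V s)) = r' V W (r' U V (\<Theta> U s))"
      using UV s opc[of W V]
      by (simp add: \<Theta> F.restriction_closed F.restriction_trans F'.restriction_trans)
  qed (use \<Theta> UV s in \<open>auto simp: F.restriction_closed F'.restriction_closed\<close>)
  have bij: "bij_betw (\<Theta> U) (carrier (F U)) (carrier (F' U))" if U: "openin T U" for U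
  proof (rule bij_betw_imageI)
    show "inj_on (\<Theta> U) (carrier (F U))"
    proof (rule inj_onI)
      fix s s' assume s: "s \<in> carrier (F U)" "s' \<in> carrier (F U)" "\<Theta> U s = \<Theta> U s'"
      show "s = s'"
      proof (rule F_eqI[OF U s(1,2)])
        fix V assume V: "V \<in> cov U"
        then show "r U V s = r U V s'"
          using \<Theta>(2)[OF U s(1) V] \<Theta>(2)[OF U s(2) V] s U opc[OF V]
          by (intro \<theta>_inj[of V]) (auto simp: F.restriction_closed)
      qed
    qed
    have "t \<in> \<Theta> U ` carrier (F U)" if t: "t \<in> carrier (F' U)" for t
    proof -
      have "\<forall>V\<in>cov U. \<exists>s. s \<in> carrier (F V) \<and> \<theta> V s = r' U V t"
        using \<theta>_surj opc U t F'.restriction_closed by metis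
      then obtain \<sigma> where \<sigma>: "\<And>V. V \<in> cov U \<Longrightarrow> \<sigma> V \<in> carrier (F V)"
          "\<And>V. V \<in> cov U \<Longrightarrow> \<theta> V (\<sigma> V) = r' U V t"
        by metis
      have "\<theta> (V \<inter> W) (r V (V \<inter> W) (\<sigma> V)) = r' U (V \<inter> W) t" "V \<inter> W \<in> B" "openin T (V \<inter> W)"
        if "V \<in> cov U" "W \<in> cov U" for V W
      proof -
        show 1: "openin T (V \<inter> W)"
          using that opc by blast
        show "V \<inter> W \<in> B"
          using that 1 down[of V "V \<inter> W"] opc by blast
        show "\<theta> (V \<inter> W) (r V (V \<inter> W) (\<sigma> V)) = r' U (V \<inter> W) t"
          using nat[of V "V \<inter> W" "\<sigma> V"] that opc[of V U] \<sigma> 1 U t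
          by (simp add: F'.restriction_trans)
      qed
      note * = this
      have "r V (V \<inter> W) (\<sigma> V) = r W (V \<inter> W) (\<sigma> W)" if VW: "V \<in> cov U" "W \<in> cov U" for V W
        using *[OF VW] *(1)[OF VW(2,1)] \<sigma>(1) VW opc(1)
        by (intro \<theta>_inj[of "V \<inter> W"] F.restriction_closed) (auto simp: Int_commute)
      then have "\<exists>s \<in> carrier (F (\<Union>(cov U))). \<forall>V\<in>cov U. r (\<Union>(cov U)) V s = \<sigma> V"
        using \<sigma>(1) opc(1) by (intro F.glue)
      then obtain s where s: "s \<in> carrier (F U)" "\<And>V. V \<in> cov U \<Longrightarrow> r U V s = \<sigma> V"
        by (auto simp: Un[OF U])
      have "\<Theta> U s = t"
      proof (rule F'_eqI[OF U \<Theta>(1)[OF U s(1)] t])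
        fix V assume "V \<in> cov U"
        then show "r' U V (\<Theta> U s) = r' U V t"
          by (simp add: \<Theta>(2)[OF U s(1)] s(2) \<sigma>(2))
      qed
      then show ?thesis
        using s by blast
    qed
    then show "\<Theta> U ` carrier (F U) = carrier (F' U)"
      using \<Theta>(1)[OF U] by blast
  qed
  show ?thesis
    unfolding sheaves_isomorphic_def sheaf_hom_def
    using F_sheaf F'_sheaf hom bij nat\<Theta> by (intro conjI exI[of _ \<Theta>]) (auto simp: iso_def)
qed

section \<open>Regular functions\<close>

text \<open>
  Without finiteness of the index set, the sum that defines a form would be the default value 0.
\<close>

lemma finite_exponents: "finite {\<alpha> :: 'k::finite \<Rightarrow> nat. (\<Sum>i\<in>UNIV. \<alpha> i) = d}"
proof (rule finite_subset)
  show "{\<alpha> :: 'k \<Rightarrow> nat. (\<Sum>i\<in>UNIV. \<alpha> i) = d} \<subseteq> (\<Pi>\<^sub>E i\<in>UNIV. {..d})"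
    by (auto simp: PiE_UNIV_domain intro: member_le_sum)
qed (intro finite_PiE; simp)

lemma homogeneous_form_monomial:
  fixes \<alpha> :: "'k::finite \<Rightarrow> nat"
  assumes "(\<Sum>i\<in>UNIV. \<alpha> i) = d"
  shows "homogeneous_form d (\<lambda>v. c * (\<Prod>i\<in>UNIV. (v $ i) ^ \<alpha> i))"
  unfolding homogeneous_form_def
proof (intro exI[of _ "\<lambda>\<beta>. if \<beta> = \<alpha> then c else 0"] ext)
  fix v :: "complex^'k"
  have "(\<Sum>\<beta> | (\<Sum>i\<in>UNIV. \<beta> i) = d. (if \<beta> = \<alpha> then c else 0) * (\<Prod>i\<in>UNIV. (v $ i) ^ \<beta> i))
      = (\<Sum>\<beta> | (\<Sum>i\<in>UNIV. \<beta> i) = d. if \<beta> = \<alpha> then c * (\<Prod>i\<in>UNIV. (v $ i) ^ \<beta> i) else 0)"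
    by (intro sum.cong) auto
  also have "\<dots> = c * (\<Prod>i\<in>UNIV. (v $ i) ^ \<alpha> i)"
    using assms by (simp add: finite_exponents)
  finally show "c * (\<Prod>i\<in>UNIV. (v $ i) ^ \<alpha> i) =
    (\<Sum>\<beta> | (\<Sum>i\<in>UNIV. \<beta> i) = d. (if \<beta> = \<alpha> then c else 0) * (\<Prod>i\<in>UNIV. (v $ i) ^ \<beta> i))"
    by simp
qed

lemma homogeneous_form_add:
  assumes "homogeneous_form d F" "homogeneous_form d G"
  shows "homogeneous_form d (\<lambda>v. F v + G v)"
proof -
  obtain b c where
    "F = (\<lambda>v. \<Sum>\<alpha> | (\<Sum>i\<in>UNIV. \<alpha> i) = d. b \<alpha> * (\<Prod>i\<in>UNIV. (v $ i) ^ \<alpha> i))"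
    "G = (\<lambda>v. \<Sum>\<alpha> | (\<Sum>i\<in>UNIV. \<alpha> i) = d. c \<alpha> * (\<Prod>i\<in>UNIV. (v $ i) ^ \<alpha> i))"
    using assms by (auto simp: homogeneous_form_def)
  then have "(\<lambda>v. F v + G v) =
      (\<lambda>v. \<Sum>\<alpha> | (\<Sum>i\<in>UNIV. \<alpha> i) = d. (b \<alpha> + c \<alpha>) * (\<Prod>i\<in>UNIV. (v $ i) ^ \<alpha> i))"
    by (simp add: sum.distrib distrib_right)
  then show ?thesis
    unfolding homogeneous_form_def by (rule exI[of _ "\<lambda>\<alpha>. b \<alpha> + c \<alpha>"])
qed

lemma homogeneous_form_zero: "homogeneous_form d (\<lambda>v. 0)"
  unfolding homogeneous_form_def by (rule exI[of _ "\<lambda>_. 0"]) simp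

lemma homogeneous_form_sum:
  assumes "\<And>x. x \<in> X \<Longrightarrow> homogeneous_form d (F x)"
  shows "homogeneous_form d (\<lambda>v. \<Sum>x\<in>X. F x v)"
  using assms
  by (induction X rule: infinite_finite_induct)
    (simp_all add: homogeneous_form_zero homogeneous_form_add)

text \<open>
  Products of monomials are monomials, and the forms of a fixed degree are closed under finite sums;
  this replaces a computation of the coefficients of the product.
\<close>

lemma homogeneous_form_mult:
  assumes "homogeneous_form d F" "homogeneous_form e G"
  shows "homogeneous_form (d + e) (\<lambda>v. F v * G v)"
proof -
  obtain b c where
    F: "F = (\<lambda>v. \<Sum>\<alpha> | (\<Sum>i\<in>UNIV. \<alpha> i) = d. b \<alpha> * (\<Prod>i\<in>UNIV. (v $ i) ^ \<alpha> i))" and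
    G: "G = (\<lambda>v. \<Sum>\<alpha> | (\<Sum>i\<in>UNIV. \<alpha> i) = e. c \<alpha> * (\<Prod>i\<in>UNIV. (v $ i) ^ \<alpha> i))"
    using assms by (auto simp: homogeneous_form_def)
  have eq: "(\<lambda>v. F v * G v) = (\<lambda>v. \<Sum>\<alpha> | (\<Sum>i\<in>UNIV. \<alpha> i) = d. \<Sum>\<beta> | (\<Sum>i\<in>UNIV. \<beta> i) = e.
      (b \<alpha> * c \<beta>) * (\<Prod>i\<in>UNIV. (v $ i) ^ (\<alpha> i + \<beta> i)))"
    unfolding F G by (simp add: sum_product power_add prod.distrib mult_ac)
  show ?thesis
    unfolding eq
    by (intro homogeneous_form_sum homogeneous_form_monomial) (simp add: sum.distrib)
qed

lemma homogeneous_form_const: "homogeneous_form 0 (\<lambda>v. c)"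
  using homogeneous_form_monomial[of "\<lambda>_. 0" 0 c] by simp

lemma homogeneous_form_scale: "homogeneous_form d F \<Longrightarrow> homogeneous_form d (\<lambda>v. c * F v)"
  using homogeneous_form_mult[OF homogeneous_form_const] by fastforce

lemma homogeneous_form_coordinate: "homogeneous_form 1 (\<lambda>v. v $ (i :: 'k::finite))"
proof -
  have "(\<Prod>j\<in>UNIV. (v $ j) ^ (if j = i then 1 else 0)) = v $ i" for v :: "complex^'k"
  proof -
    have "(\<Prod>j\<in>UNIV. (v $ j) ^ (if j = i then 1 else 0)) = (\<Prod>j\<in>UNIV. if j = i then v $ j else 1)"
      by (intro prod.cong) auto
    then show ?thesis
      by simp
  qed
  then show ?thesis
    using homogeneous_form_monomial[of "\<lambda>j. if j = i then 1 else 0" 1 1] by simp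
qed

lemma homogeneous_form_coordinate_power:
  "homogeneous_form d (\<lambda>v. (v $ (i :: 'k::finite)) ^ d)"
proof (induction d)
  case (Suc d)
  then show ?case
    using homogeneous_form_mult[OF homogeneous_form_coordinate Suc, of i] by simp
qed (simp add: homogeneous_form_const)

lemma homogeneous_form_scaling:
  assumes "homogeneous_form d F"
  shows "F (c *s v) = c ^ d * F v"
proof -
  obtain b where F: "F = (\<lambda>v. \<Sum>\<alpha> | (\<Sum>i\<in>UNIV. \<alpha> i) = d. b \<alpha> * (\<Prod>i\<in>UNIV. (v $ i) ^ \<alpha> i))"
    using assms by (auto simp: homogeneous_form_def)
  have "(\<Prod>i\<in>UNIV. ((c *s v) $ i) ^ \<alpha> i) = c ^ d * (\<Prod>i\<in>UNIV. (v $ i) ^ \<alpha> i)"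
    if "(\<Sum>i\<in>UNIV. \<alpha> i) = d" for \<alpha>
    using that by (auto simp: power_mult_distrib prod.distrib power_sum)
  then show ?thesis
    by (simp add: F sum_distrib_left mult_ac)
qed

definition quotient_of_forms_on :: "('k::finite) pt set \<Rightarrow> ('k pt \<Rightarrow> complex) \<Rightarrow> bool" where
  "quotient_of_forms_on W f \<longleftrightarrow> (\<exists>d F G. homogeneous_form d F \<and> homogeneous_form d G \<and>
     (\<forall>q\<in>W. \<forall>v\<in>q - {0}. G v \<noteq> 0 \<and> f q = F v / G v))"

lemma quotient_of_forms_on_cong:
  assumes "quotient_of_forms_on W f" "W' \<subseteq> W" "\<And>q. q \<in> W' \<Longrightarrow> f' q = f q"
  shows "quotient_of_forms_on W' f'"
  using assms unfolding quotient_of_forms_on_def by (metis in_mono)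

lemma quotient_of_forms_on_add:
  assumes "quotient_of_forms_on W f" "quotient_of_forms_on W g"
  shows "quotient_of_forms_on W (\<lambda>q. f q + g q)"
proof -
  obtain d F G where F: "homogeneous_form d F" "homogeneous_form d G"
      "\<And>q v. q \<in> W \<Longrightarrow> v \<in> q - {0} \<Longrightarrow> G v \<noteq> 0 \<and> f q = F v / G v"
    using assms(1) unfolding quotient_of_forms_on_def by blast
  obtain e F' G' where F': "homogeneous_form e F'" "homogeneous_form e G'"
      "\<And>q v. q \<in> W \<Longrightarrow> v \<in> q - {0} \<Longrightarrow> G' v \<noteq> 0 \<and> g q = F' v / G' v"
    using assms(2) unfolding quotient_of_forms_on_def by blast
  have "homogeneous_form (d + e) (\<lambda>v. F v * G' v + G v * F' v)"
    "homogeneous_form (d + e) (\<lambda>v. G v * G' v)"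
    using F F' by (auto intro: homogeneous_form_add homogeneous_form_mult)
  moreover have "G v * G' v \<noteq> 0 \<and> f q + g q = (F v * G' v + G v * F' v) / (G v * G' v)"
    if "q \<in> W" "v \<in> q - {0}" for q v
    using F(3)[OF that] F'(3)[OF that] by (simp add: field_simps)
  ultimately show ?thesis
    unfolding quotient_of_forms_on_def by blast
qed

lemma quotient_of_forms_on_mult:
  assumes "quotient_of_forms_on W f" "quotient_of_forms_on W g"
  shows "quotient_of_forms_on W (\<lambda>q. f q * g q)"
proof -
  obtain d F G where F: "homogeneous_form d F" "homogeneous_form d G"
      "\<And>q v. q \<in> W \<Longrightarrow> v \<in> q - {0} \<Longrightarrow> G v \<noteq> 0 \<and> f q = F v / G v"
    using assms(1) unfolding quotient_of_forms_on_def by blast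
  obtain e F' G' where F': "homogeneous_form e F'" "homogeneous_form e G'"
      "\<And>q v. q \<in> W \<Longrightarrow> v \<in> q - {0} \<Longrightarrow> G' v \<noteq> 0 \<and> g q = F' v / G' v"
    using assms(2) unfolding quotient_of_forms_on_def by blast
  have "homogeneous_form (d + e) (\<lambda>v. F v * F' v)" "homogeneous_form (d + e) (\<lambda>v. G v * G' v)"
    using F F' by (auto intro: homogeneous_form_mult)
  moreover have "G v * G' v \<noteq> 0 \<and> f q * g q = (F v * F' v) / (G v * G' v)"
    if "q \<in> W" "v \<in> q - {0}" for q v
    using F(3)[OF that] F'(3)[OF that] by simp
  ultimately show ?thesis
    unfolding quotient_of_forms_on_def by blast
qed

lemma quotient_of_forms_on_const: "quotient_of_forms_on W (\<lambda>q. c)"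
  unfolding quotient_of_forms_on_def
  by (intro exI[of _ 0] exI[of _ "\<lambda>v. c"] exI[of _ "\<lambda>v. 1"]) (simp add: homogeneous_form_const)

lemma regular_functions_iff:
  "f \<in> regular_functions C U \<longleftrightarrow> f \<in> extensional U \<and>
     (\<forall>p\<in>U. \<exists>W. openin (zariski_on C) W \<and> p \<in> W \<and> W \<subseteq> U \<and> quotient_of_forms_on W f)"
  by (simp add: regular_functions_def quotient_of_forms_on_def)

lemma regular_functions_extensional: "f \<in> regular_functions C U \<Longrightarrow> f \<in> extensional U"
  by (simp add: regular_functions_iff)

lemma regular_functions_const:
  assumes "openin (zariski_on C) U"
  shows "(\<lambda>p\<in>U. c) \<in> regular_functions C U"
proof -
  have "quotient_of_forms_on U (\<lambda>p\<in>U. c)"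
    by (rule quotient_of_forms_on_cong[OF quotient_of_forms_on_const[of U c]]) auto
  then show ?thesis
    using assms by (auto simp: regular_functions_iff)
qed

text \<open>
  Sums and products are handled together: two local representations as quotients are combined on the
  intersection of their domains.
\<close>

lemma regular_functions_pointwise:
  fixes C U :: "('k::finite) pt set"
  assumes op: "\<And>(W :: 'k pt set) f' g'. quotient_of_forms_on W f' \<Longrightarrow> quotient_of_forms_on W g'
      \<Longrightarrow> quotient_of_forms_on W (\<lambda>q. h (f' q) (g' q))"
    and f: "f \<in> regular_functions C U" and g: "g \<in> regular_functions C U"
  shows "(\<lambda>p\<in>U. h (f p) (g p)) \<in> regular_functions C U"
  unfolding regular_functions_iff
proof (intro conjI ballI)
  fix p assume p: "p \<in> U"
  obtain W where W: "openin (zariski_on C) W" "p \<in> W" "W \<subseteq> U" "quotient_of_forms_on W f"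
    using f p by (auto simp: regular_functions_iff)
  obtain W' where W': "openin (zariski_on C) W'" "p \<in> W'" "W' \<subseteq> U" "quotient_of_forms_on W' g"
    using g p by (auto simp: regular_functions_iff)
  have "quotient_of_forms_on (W \<inter> W') f" "quotient_of_forms_on (W \<inter> W') g"
    using quotient_of_forms_on_cong[OF W(4)] quotient_of_forms_on_cong[OF W'(4)] by auto
  then have "quotient_of_forms_on (W \<inter> W') (\<lambda>q. h (f q) (g q))"
    by (rule op)
  then have "quotient_of_forms_on (W \<inter> W') (\<lambda>p\<in>U. h (f p) (g p))"
    by (rule quotient_of_forms_on_cong) (use W in auto)
  then show "\<exists>W. openin (zariski_on C) W \<and> p \<in> W \<and> W \<subseteq> U
      \<and> quotient_of_forms_on W (\<lambda>p\<in>U. h (f p) (g p))"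
    using W W' by (intro exI[of _ "W \<inter> W'"]) auto
qed auto

lemma regular_functions_add:
  "f \<in> regular_functions C U \<Longrightarrow> g \<in> regular_functions C U \<Longrightarrow> (\<lambda>p\<in>U. f p + g p) \<in> regular_functions C U"
  by (rule regular_functions_pointwise[OF quotient_of_forms_on_add])

lemma regular_functions_mult:
  "f \<in> regular_functions C U \<Longrightarrow> g \<in> regular_functions C U \<Longrightarrow> (\<lambda>p\<in>U. f p * g p) \<in> regular_functions C U"
  by (rule regular_functions_pointwise[OF quotient_of_forms_on_mult])

lemma regular_functions_scale:
  "f \<in> regular_functions C U \<Longrightarrow> (\<lambda>p\<in>U. c * f p) \<in> regular_functions C U"
  using regular_functions_pointwise[of "\<lambda>x y. c * x" f C U f]
    quotient_of_forms_on_mult[OF quotient_of_forms_on_const] by blast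

lemma regular_functions_sum:
  assumes "openin (zariski_on C) U" "finite I" "\<And>i. i \<in> I \<Longrightarrow> f i \<in> regular_functions C U"
  shows "(\<lambda>p\<in>U. \<Sum>i\<in>I. f i p) \<in> regular_functions C U"
  using assms(2,3)
proof (induction I)
  case empty
  then show ?case
    using regular_functions_const[OF assms(1), of 0] by (simp only: sum.empty)
next
  case (insert j I)
  then have "(\<lambda>p\<in>U. f j p + (\<lambda>p\<in>U. \<Sum>i\<in>I. f i p) p) \<in> regular_functions C U"
    by (intro regular_functions_add) auto
  also have "(\<lambda>p\<in>U. f j p + (\<lambda>p\<in>U. \<Sum>i\<in>I. f i p) p) = (\<lambda>p\<in>U. \<Sum>i\<in>insert j I. f i p)"
    using insert by (auto intro: restrict_ext)
  finally show ?case .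
qed

lemma regular_functions_restrict:
  assumes f: "f \<in> regular_functions C U" and V: "openin (zariski_on C) V" "V \<subseteq> U"
  shows "restrict f V \<in> regular_functions C V"
  unfolding regular_functions_iff
proof (intro conjI ballI)
  fix p assume p: "p \<in> V"
  then obtain W where W: "openin (zariski_on C) W" "p \<in> W" "W \<subseteq> U" "quotient_of_forms_on W f"
    using f V unfolding regular_functions_iff by blast
  have "quotient_of_forms_on (W \<inter> V) (restrict f V)"
    by (rule quotient_of_forms_on_cong[OF W(4)]) auto
  then show "\<exists>W. openin (zariski_on C) W \<and> p \<in> W \<and> W \<subseteq> V \<and> quotient_of_forms_on W (restrict f V)"
    using W V p by (intro exI[of _ "W \<inter> V"]) auto
qed auto

lemma regular_functions_local:
  assumes "f \<in> extensional U"
    and loc: "\<And>p. p \<in> U \<Longrightarrow> \<exists>V. p \<in> V \<and> V \<subseteq> U \<and> restrict f V \<in> regular_functions C V"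
  shows "f \<in> regular_functions C U"
  unfolding regular_functions_iff
proof (intro conjI ballI)
  fix p assume "p \<in> U"
  then obtain V where V: "p \<in> V" "V \<subseteq> U" "restrict f V \<in> regular_functions C V"
    using loc by blast
  then obtain W where W: "openin (zariski_on C) W" "p \<in> W" "W \<subseteq> V"
      "quotient_of_forms_on W (restrict f V)"
    by (auto simp: regular_functions_iff)
  have "quotient_of_forms_on W f"
    by (rule quotient_of_forms_on_cong[OF W(4)]) (use W in auto)
  then show "\<exists>W. openin (zariski_on C) W \<and> p \<in> W \<and> W \<subseteq> U \<and> quotient_of_forms_on W f"
    using V W by blast
qed fact

lemma structure_sheaf_simps [simp]:
  "carrier (\<O> C U) = regular_functions C U"
  "f \<otimes>\<^bsub>\<O> C U\<^esub> g = (\<lambda>p\<in>U. f p * g p)"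
  "\<one>\<^bsub>\<O> C U\<^esub> = (\<lambda>p\<in>U. 1)"
  "\<zero>\<^bsub>\<O> C U\<^esub> = (\<lambda>p\<in>U. 0)"
  "f \<oplus>\<^bsub>\<O> C U\<^esub> g = (\<lambda>p\<in>U. f p + g p)"
  "c \<odot>\<^bsub>\<O> C U\<^esub> f = (\<lambda>p\<in>U. c * f p)"
  by (simp_all add: \<O>_def)

lemma structure_sheaf_is_sheaf:
  "sheaf_of_groups (zariski_on C) (\<lambda>U. add_monoid (\<O> C U)) (\<lambda>U V f. restrict f V)"
proof (rule sheaf_of_groups.intro)
  fix U assume U: "openin (zariski_on C) U"
  show "group (add_monoid (\<O> C U))"
  proof (rule groupI)
    fix f assume f: "f \<in> carrier (add_monoid (\<O> C U))"
    then show "\<exists>g\<in>carrier (add_monoid (\<O> C U)). g \<otimes>\<^bsub>add_monoid (\<O> C U)\<^esub> f = \<one>\<^bsub>add_monoid (\<O> C U)\<^esub>"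
      using regular_functions_scale[of f C U "-1"]
      by (intro bexI[of _ "\<lambda>p\<in>U. -1 * f p"]) (auto intro: restrict_ext)
    have "(\<lambda>p\<in>U. (\<lambda>p\<in>U. 0) p + f p) = f"
      by (rule extensionalityI[of _ U]) (use f in \<open>auto dest: regular_functions_extensional\<close>)
    then show "\<one>\<^bsub>add_monoid (\<O> C U)\<^esub> \<otimes>\<^bsub>add_monoid (\<O> C U)\<^esub> f = f"
      by simp
  qed (auto intro: regular_functions_const regular_functions_add U restrict_ext)
next
  fix U V assume "openin (zariski_on C) U" "openin (zariski_on C) V" "V \<subseteq> U"
  then show "(\<lambda>f. restrict f V) \<in> hom (add_monoid (\<O> C U)) (add_monoid (\<O> C V))"
    by (intro homI) (auto simp: regular_functions_restrict fun_eq_iff)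
next
  fix U f assume "f \<in> carrier (add_monoid (\<O> C U))"
  then show "restrict f U = f"
    by (auto simp: extensional_restrict dest: regular_functions_extensional)
next
  fix \<U> \<sigma>
  assume op: "\<forall>V\<in>\<U>. openin (zariski_on C) V" and \<sigma>: "\<forall>V\<in>\<U>. \<sigma> V \<in> carrier (add_monoid (\<O> C V))"
    and compat: "\<forall>V\<in>\<U>. \<forall>W\<in>\<U>. restrict (\<sigma> V) (V \<inter> W) = restrict (\<sigma> W) (V \<inter> W)"
  define s where "s = (\<lambda>p\<in>\<Union>\<U>. \<sigma> (SOME V. V \<in> \<U> \<and> p \<in> V) p)"
  have s_eq: "s p = \<sigma> V p" if V: "V \<in> \<U>" "p \<in> V" for V p
  proof -
    define W where "W = (SOME V. V \<in> \<U> \<and> p \<in> V)"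
    have W: "W \<in> \<U>" "p \<in> W"
      using someI[of "\<lambda>V. V \<in> \<U> \<and> p \<in> V" V] V unfolding W_def by auto
    have "restrict (\<sigma> V) (V \<inter> W) = restrict (\<sigma> W) (V \<inter> W)"
      using compat V W by blast
    then have "restrict (\<sigma> V) (V \<inter> W) p = restrict (\<sigma> W) (V \<inter> W) p"
      by (rule fun_cong)
    then show ?thesis
      using V W by (auto simp: s_def W_def[symmetric])
  qed
  have restr: "restrict s V = \<sigma> V" if "V \<in> \<U>" for V
    by (rule extensionalityI[of _ V])
      (use that \<sigma> s_eq in \<open>auto dest: regular_functions_extensional\<close>)
  have "s \<in> regular_functions C (\<Union>\<U>)"
  proof (rule regular_functions_local)
    fix p assume "p \<in> \<Union>\<U>"
    then show "\<exists>V. p \<in> V \<and> V \<subseteq> \<Union>\<U> \<and> restrict s V \<in> regular_functions C V"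
      using restr \<sigma> by auto
  qed (simp add: s_def)
  then have "s \<in> carrier (add_monoid (\<O> C (\<Union>\<U>))) \<and> (\<forall>V\<in>\<U>. restrict s V = \<sigma> V)"
    using restr by simp
  moreover have "u = s"
    if u: "u \<in> carrier (add_monoid (\<O> C (\<Union>\<U>))) \<and> (\<forall>V\<in>\<U>. restrict u V = \<sigma> V)" for u
  proof (rule extensionalityI[of _ "\<Union>\<U>"])
    show "u \<in> extensional (\<Union>\<U>)"
      using u by (auto dest: regular_functions_extensional)
    fix p assume "p \<in> \<Union>\<U>"
    then obtain V where V: "V \<in> \<U>" "p \<in> V"
      by blast
    then have "u p = restrict u V p"
      by simp
    also have "\<dots> = s p"
      using u V s_eq by simp
    finally show "u p = s p" .
  qed (simp add: s_def)
  ultimately show "\<exists>!s. s \<in> carrier (add_monoid (\<O> C (\<Union>\<U>))) \<and> (\<forall>V\<in>\<U>. restrict s V = \<sigma> V)"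
    by (rule ex1I)
qed (auto simp: Int_absorb1)

section \<open>The tangent sheaf\<close>

text \<open>
  All functions involved are extensional, so the defining equations between functions amount to
  equations between values. This is the form in which derivations are used below.
\<close>

lemma derivations_iff:
  assumes U: "openin (zariski_on C) U"
  shows "D \<in> derivations C U \<longleftrightarrow>
    D \<in> regular_functions C U \<rightarrow>\<^sub>E regular_functions C U \<and>
    (\<forall>f \<in> regular_functions C U. \<forall>g \<in> regular_functions C U. \<forall>p\<in>U.
       D (\<lambda>p\<in>U. f p + g p) p = D f p + D g p) \<and>
    (\<forall>c. \<forall>f \<in> regular_functions C U. \<forall>p\<in>U. D (\<lambda>p\<in>U. c * f p) p = c * D f p) \<and>
    (\<forall>f \<in> regular_functions C U. \<forall>g \<in> regular_functions C U. \<forall>p\<in>U.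
       D (\<lambda>p\<in>U. f p * g p) p = f p * D g p + g p * D f p)"
proof -
  have eq: "h = (\<lambda>p\<in>U. e p) \<longleftrightarrow> (\<forall>p\<in>U. h p = e p)" if "h \<in> regular_functions C U" for h and e :: "_ \<Rightarrow> complex"
  proof
    assume "\<forall>p\<in>U. h p = e p"
    then show "h = (\<lambda>p\<in>U. e p)"
      by (intro extensionalityI[of _ U]) (use that in \<open>auto dest: regular_functions_extensional\<close>)
  qed simp
  have closed: "D f \<in> regular_functions C U"
    if "D \<in> regular_functions C U \<rightarrow>\<^sub>E regular_functions C U" "f \<in> regular_functions C U" for f
    using that by auto
  have prod: "(\<lambda>p\<in>U. (\<lambda>p\<in>U. f p * D g p) p + (\<lambda>p\<in>U. g p * D f p) p)
      = (\<lambda>p\<in>U. f p * D g p + g p * D f p)" for f g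
    by auto
  show ?thesis
    unfolding derivations_def mem_Collect_eq structure_sheaf_simps prod
    by (intro conj_cong ball_cong iff_allI refl eq closed regular_functions_add
        regular_functions_scale regular_functions_mult)
qed

lemma derivations_closed:
  "D \<in> derivations C U \<Longrightarrow> f \<in> regular_functions C U \<Longrightarrow> D f \<in> regular_functions C U"
  by (auto simp: derivations_def)

lemma derivations_add:
  "D \<in> derivations C U \<Longrightarrow> openin (zariski_on C) U \<Longrightarrow> f \<in> regular_functions C U \<Longrightarrow> g \<in> regular_functions C U
    \<Longrightarrow> p \<in> U \<Longrightarrow> D (\<lambda>p\<in>U. f p + g p) p = D f p + D g p"
  by (simp add: derivations_iff)

lemma derivations_scale:
  "D \<in> derivations C U \<Longrightarrow> openin (zariski_on C) U \<Longrightarrow> f \<in> regular_functions C U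
    \<Longrightarrow> p \<in> U \<Longrightarrow> D (\<lambda>p\<in>U. c * f p) p = c * D f p"
  by (simp add: derivations_iff)

lemma derivations_mult:
  "D \<in> derivations C U \<Longrightarrow> openin (zariski_on C) U \<Longrightarrow> f \<in> regular_functions C U \<Longrightarrow> g \<in> regular_functions C U
    \<Longrightarrow> p \<in> U \<Longrightarrow> D (\<lambda>p\<in>U. f p * g p) p = f p * D g p + g p * D f p"
  by (simp add: derivations_iff)

abbreviation opens_within :: "('k::finite) pt set \<Rightarrow> 'k pt set \<Rightarrow> 'k pt set set" where
  "opens_within C U \<equiv> {V. openin (zariski_on C) V \<and> V \<subseteq> U}"

lemma tangent_sheafI:
  assumes "D \<in> extensional (opens_within C U)"
    and "\<And>V. openin (zariski_on C) V \<Longrightarrow> V \<subseteq> U \<Longrightarrow> D V \<in> derivations C V"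
    and "\<And>V W f p. openin (zariski_on C) V \<Longrightarrow> openin (zariski_on C) W \<Longrightarrow> W \<subseteq> V \<Longrightarrow> V \<subseteq> U
      \<Longrightarrow> f \<in> regular_functions C V \<Longrightarrow> p \<in> W \<Longrightarrow> D W (restrict f W) p = D V f p"
  shows "D \<in> carrier (tangent_sheaf C U)"
proof -
  have "D W (restrict f W) = restrict (D V f) W"
    if "openin (zariski_on C) V" "openin (zariski_on C) W" "W \<subseteq> V" "V \<subseteq> U" "f \<in> regular_functions C V"
    for V W f
  proof (rule extensionalityI[of _ W])
    have "D W (restrict f W) \<in> regular_functions C W"
      using that assms(2)[of W] regular_functions_restrict[of f C V W] by (auto intro: derivations_closed)
    then show "D W (restrict f W) \<in> extensional W"
      by (rule regular_functions_extensional)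
  qed (use that assms(3) in auto)
  then show ?thesis
    using assms(1,2) by (auto simp: tangent_sheaf_def PiE_iff)
qed

lemma tangent_sheaf_derivation:
  "D \<in> carrier (tangent_sheaf C U) \<Longrightarrow> openin (zariski_on C) V \<Longrightarrow> V \<subseteq> U \<Longrightarrow> D V \<in> derivations C V"
  by (auto simp: tangent_sheaf_def)

lemma tangent_sheaf_extensional:
  "D \<in> carrier (tangent_sheaf C U) \<Longrightarrow> D \<in> extensional (opens_within C U)"
  by (auto simp: tangent_sheaf_def PiE_iff)

lemma tangent_sheaf_restrict:
  assumes "D \<in> carrier (tangent_sheaf C U)"
    "openin (zariski_on C) V" "openin (zariski_on C) W" "W \<subseteq> V" "V \<subseteq> U"
    "f \<in> regular_functions C V" "p \<in> W"
  shows "D W (restrict f W) p = D V f p"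
proof -
  have "D W (restrict f W) = restrict (D V f) W"
    using assms by (auto simp: tangent_sheaf_def)
  then show ?thesis
    using assms by simp
qed

lemma tangent_sheaf_eqI:
  assumes D: "D \<in> carrier (tangent_sheaf C U)" and E: "E \<in> carrier (tangent_sheaf C U)"
    and eq: "\<And>V f p. openin (zariski_on C) V \<Longrightarrow> V \<subseteq> U \<Longrightarrow> f \<in> regular_functions C V \<Longrightarrow> p \<in> V
      \<Longrightarrow> D V f p = E V f p"
  shows "D = E"
proof (rule extensionalityI[OF tangent_sheaf_extensional[OF D] tangent_sheaf_extensional[OF E]])
  fix V assume "V \<in> opens_within C U"
  then have V: "openin (zariski_on C) V" "V \<subseteq> U"
    by auto
  have DV: "D V \<in> derivations C V" and EV: "E V \<in> derivations C V"
    using tangent_sheaf_derivation[OF _ V] D E by auto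
  show "D V = E V"
  proof (rule extensionalityI[of _ "regular_functions C V"])
    fix f assume f: "f \<in> regular_functions C V"
    show "D V f = E V f"
      by (rule extensionalityI[of _ V])
        (use eq[OF V f] derivations_closed[OF DV f] derivations_closed[OF EV f] in
          \<open>auto dest: regular_functions_extensional\<close>)
  qed (use DV EV in \<open>auto simp: derivations_def PiE_iff\<close>)
qed

text \<open>
  The coefficients \<open>1, 1\<close> give the group operation, the coefficients \<open>-1, 0\<close> the inverse.
\<close>

lemma tangent_sheaf_linear_combination:
  assumes D: "D \<in> carrier (tangent_sheaf C U)" and E: "E \<in> carrier (tangent_sheaf C U)"
  shows "(\<lambda>V \<in> opens_within C U. \<lambda>f \<in> regular_functions C V. \<lambda>p\<in>V. a * D V f p + b * E V f p)
    \<in> carrier (tangent_sheaf C U)"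
proof (rule tangent_sheafI)
  fix V assume V: "openin (zariski_on C) V" "V \<subseteq> U"
  have DV: "D V \<in> derivations C V" and EV: "E V \<in> derivations C V"
    using tangent_sheaf_derivation[OF _ V] D E by auto
  have closed: "(\<lambda>p\<in>V. a * D V f p + b * E V f p) \<in> regular_functions C V"
    if f: "f \<in> regular_functions C V" for f
  proof -
    have "(\<lambda>p\<in>V. (\<lambda>p\<in>V. a * D V f p) p + (\<lambda>p\<in>V. b * E V f p) p) \<in> regular_functions C V"
      by (intro regular_functions_add regular_functions_scale derivations_closed[OF DV f]
          derivations_closed[OF EV f])
    then show ?thesis
      by (simp cong: restrict_cong)
  qed
  show "(\<lambda>V \<in> opens_within C U. \<lambda>f \<in> regular_functions C V. \<lambda>p\<in>V. a * D V f p + b * E V f p) V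
      \<in> derivations C V"
    using V DV EV
    by (simp add: derivations_iff closed regular_functions_add regular_functions_scale
        regular_functions_mult algebra_simps)
next
  fix V W f p
  assume "openin (zariski_on C) V" "openin (zariski_on C) W" "W \<subseteq> V" "V \<subseteq> U"
      "f \<in> regular_functions C V" "p \<in> W"
  then show "(\<lambda>V \<in> opens_within C U. \<lambda>f \<in> regular_functions C V. \<lambda>p\<in>V. a * D V f p + b * E V f p) W (restrict f W) p
      = (\<lambda>V \<in> opens_within C U. \<lambda>f \<in> regular_functions C V. \<lambda>p\<in>V. a * D V f p + b * E V f p) V f p"
    by (auto simp: regular_functions_restrict tangent_sheaf_restrict[OF D] tangent_sheaf_restrict[OF E])
qed simp

lemma tangent_sheaf_mult:
  "D \<otimes>\<^bsub>tangent_sheaf C U\<^esub> E =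
    (\<lambda>V \<in> opens_within C U. \<lambda>f \<in> regular_functions C V. \<lambda>p\<in>V. D V f p + E V f p)"
  by (simp add: tangent_sheaf_def)

lemma tangent_sheaf_one:
  "\<one>\<^bsub>tangent_sheaf C U\<^esub> = (\<lambda>V \<in> opens_within C U. \<lambda>f \<in> regular_functions C V. \<lambda>p\<in>V. 0)"
  by (simp add: tangent_sheaf_def)

lemma tangent_sheaf_one_closed: "\<one>\<^bsub>tangent_sheaf C U\<^esub> \<in> carrier (tangent_sheaf C U)"
  unfolding tangent_sheaf_one
proof (rule tangent_sheafI)
  fix V assume "openin (zariski_on C) V" "V \<subseteq> U"
  then show "(\<lambda>V \<in> opens_within C U. \<lambda>f \<in> regular_functions C V. \<lambda>p\<in>V. 0) V \<in> derivations C V"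
    by (simp add: derivations_iff regular_functions_const regular_functions_add
        regular_functions_scale regular_functions_mult)
qed (auto simp: regular_functions_restrict)

lemma tangent_sheaf_mult_closed:
  assumes "D \<in> carrier (tangent_sheaf C U)" "E \<in> carrier (tangent_sheaf C U)"
  shows "D \<otimes>\<^bsub>tangent_sheaf C U\<^esub> E \<in> carrier (tangent_sheaf C U)"
  using tangent_sheaf_linear_combination[OF assms, of 1 1] by (simp add: tangent_sheaf_mult)

lemma tangent_sheaf_group: "group (tangent_sheaf C U)"
proof (rule groupI)
  fix D assume D: "D \<in> carrier (tangent_sheaf C U)"
  show "\<one>\<^bsub>tangent_sheaf C U\<^esub> \<otimes>\<^bsub>tangent_sheaf C U\<^esub> D = D"
    by (rule tangent_sheaf_eqI[OF tangent_sheaf_mult_closed[OF tangent_sheaf_one_closed D] D])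
      (simp add: tangent_sheaf_mult tangent_sheaf_one)
  let ?E = "\<lambda>V \<in> opens_within C U. \<lambda>f \<in> regular_functions C V. \<lambda>p\<in>V. -1 * D V f p + 0 * D V f p"
  have E: "?E \<in> carrier (tangent_sheaf C U)"
    by (rule tangent_sheaf_linear_combination[OF D D])
  have "?E \<otimes>\<^bsub>tangent_sheaf C U\<^esub> D = \<one>\<^bsub>tangent_sheaf C U\<^esub>"
    by (rule tangent_sheaf_eqI[OF tangent_sheaf_mult_closed[OF E D] tangent_sheaf_one_closed])
      (simp add: tangent_sheaf_mult tangent_sheaf_one)
  with E show "\<exists>E \<in> carrier (tangent_sheaf C U). E \<otimes>\<^bsub>tangent_sheaf C U\<^esub> D = \<one>\<^bsub>tangent_sheaf C U\<^esub>"
    by blast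
next
  fix D E G
  assume D: "D \<in> carrier (tangent_sheaf C U)" and E: "E \<in> carrier (tangent_sheaf C U)"
    and G: "G \<in> carrier (tangent_sheaf C U)"
  show "D \<otimes>\<^bsub>tangent_sheaf C U\<^esub> E \<otimes>\<^bsub>tangent_sheaf C U\<^esub> G
      = D \<otimes>\<^bsub>tangent_sheaf C U\<^esub> (E \<otimes>\<^bsub>tangent_sheaf C U\<^esub> G)"
    by (rule tangent_sheaf_eqI[OF tangent_sheaf_mult_closed[OF tangent_sheaf_mult_closed[OF D E] G]
          tangent_sheaf_mult_closed[OF D tangent_sheaf_mult_closed[OF E G]]])
      (simp add: tangent_sheaf_mult)
qed (simp_all add: tangent_sheaf_one_closed tangent_sheaf_mult_closed)

lemma tangent_sheaf_restrict_closed: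
  assumes "D \<in> carrier (tangent_sheaf C U)" "V \<subseteq> U"
  shows "restrict D (opens_within C V) \<in> carrier (tangent_sheaf C V)"
proof (rule tangent_sheafI)
  fix W assume "openin (zariski_on C) W" "W \<subseteq> V"
  then show "restrict D (opens_within C V) W \<in> derivations C W"
    using assms tangent_sheaf_derivation[OF assms(1), of W] by auto
next
  fix W W' f p
  assume "openin (zariski_on C) W" "openin (zariski_on C) W'" "W' \<subseteq> W" "W \<subseteq> V"
    "f \<in> regular_functions C W" "p \<in> W'"
  then show "restrict D (opens_within C V) W' (restrict f W') p = restrict D (opens_within C V) W f p"
    using tangent_sheaf_restrict[OF assms(1), of W W' f p] assms(2) by auto
qed simp

text \<open>
  To glue derivations, apply at a point \<open>p\<close> the given derivation over some member \<open>N p\<close> of the cover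
  that contains \<open>p\<close>. Compatibility with restrictions makes the value independent of the choice, so
  that all properties of derivations can be checked inside one member of the cover.
\<close>

lemma tangent_sheaf_is_sheaf:
  fixes C :: "('k::finite) pt set"
  shows "sheaf_of_groups (zariski_on C) (tangent_sheaf C) (\<lambda>U V D. restrict D (opens_within C V))"
proof (rule sheaf_of_groups.intro)
  show "group (tangent_sheaf C U)" for U
    by (rule tangent_sheaf_group)
next
  fix U V assume "openin (zariski_on C) U" "openin (zariski_on C) V" "V \<subseteq> U"
  then show "(\<lambda>D. restrict D (opens_within C V)) \<in> hom (tangent_sheaf C U) (tangent_sheaf C V)"
  proof (intro homI)
    fix D E
    show "restrict (D \<otimes>\<^bsub>tangent_sheaf C U\<^esub> E) (opens_within C V)
        = restrict D (opens_within C V) \<otimes>\<^bsub>tangent_sheaf C V\<^esub> restrict E (opens_within C V)"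
      by (rule extensionalityI[of _ "opens_within C V"])
        (use \<open>V \<subseteq> U\<close> in \<open>auto simp: tangent_sheaf_mult\<close>)
  qed (simp add: tangent_sheaf_restrict_closed)
next
  fix U D assume "D \<in> carrier (tangent_sheaf C U)"
  then show "restrict D (opens_within C U) = D"
    by (simp add: extensional_restrict tangent_sheaf_extensional)
next
  fix U V W :: "'k pt set" and D :: "'k pt set \<Rightarrow> ('k pt \<Rightarrow> complex) \<Rightarrow> 'k pt \<Rightarrow> complex"
  assume "W \<subseteq> V" "V \<subseteq> U"
  then show "restrict (restrict D (opens_within C V)) (opens_within C W) = restrict D (opens_within C W)"
    by (auto simp: fun_eq_iff)
next
  fix \<U> \<sigma>
  assume op: "\<forall>V\<in>\<U>. openin (zariski_on C) V" and \<sigma>: "\<forall>V\<in>\<U>. \<sigma> V \<in> carrier (tangent_sheaf C V)"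
    and compat: "\<forall>V\<in>\<U>. \<forall>W\<in>\<U>.
      restrict (\<sigma> V) (opens_within C (V \<inter> W)) = restrict (\<sigma> W) (opens_within C (V \<inter> W))"
  have agree: "\<sigma> V X = \<sigma> W X" if "V \<in> \<U>" "W \<in> \<U>" "openin (zariski_on C) X" "X \<subseteq> V" "X \<subseteq> W" for V W X
  proof -
    have "restrict (\<sigma> V) (opens_within C (V \<inter> W)) = restrict (\<sigma> W) (opens_within C (V \<inter> W))"
      using compat that by blast
    then have "restrict (\<sigma> V) (opens_within C (V \<inter> W)) X = restrict (\<sigma> W) (opens_within C (V \<inter> W)) X"
      by (rule fun_cong)
    then show ?thesis
      using that by simp
  qed
  define N where "N p = (SOME V. V \<in> \<U> \<and> p \<in> V)" for p
  have N: "N p \<in> \<U>" "p \<in> N p" if "p \<in> \<Union>\<U>" for p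
    using someI_ex[of "\<lambda>V. V \<in> \<U> \<and> p \<in> V"] that unfolding N_def by auto
  define s where "s = (\<lambda>X \<in> opens_within C (\<Union>\<U>). \<lambda>f \<in> regular_functions C X.
    \<lambda>p\<in>X. \<sigma> (N p) (X \<inter> N p) (restrict f (X \<inter> N p)) p)"
  have s_eq: "s X f p = \<sigma> V (X \<inter> V) (restrict f (X \<inter> V)) p"
    if X: "openin (zariski_on C) X" "X \<subseteq> \<Union>\<U>" and f: "f \<in> regular_functions C X"
      and p: "p \<in> X" "p \<in> V" and V: "V \<in> \<U>" for X f p V
  proof -
    have Np: "N p \<in> \<U>" "p \<in> N p"
      using N[of p] X p by blast+
    define Y where "Y = X \<inter> V \<inter> N p"
    have opens: "openin (zariski_on C) Y" "openin (zariski_on C) (X \<inter> V)" "openin (zariski_on C) (X \<inter> N p)"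
      using X V Np op by (auto simp: Y_def)
    have f': "restrict f (X \<inter> V) \<in> regular_functions C (X \<inter> V)"
      "restrict f (X \<inter> N p) \<in> regular_functions C (X \<inter> N p)"
      using opens by (auto intro: regular_functions_restrict[OF f])
    have "s X f p = \<sigma> (N p) (X \<inter> N p) (restrict f (X \<inter> N p)) p"
      using X f p by (simp add: s_def)
    also have "\<dots> = \<sigma> (N p) Y (restrict (restrict f (X \<inter> N p)) Y) p"
    proof (rule tangent_sheaf_restrict[of "\<sigma> (N p)" C "N p", symmetric])
      show "\<sigma> (N p) \<in> carrier (tangent_sheaf C (N p))"
        using \<sigma> Np by blast
    qed (use Np opens p f' in \<open>auto simp: Y_def\<close>)
    also have "restrict (restrict f (X \<inter> N p)) Y = restrict (restrict f (X \<inter> V)) Y"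
      by (auto simp: Y_def)
    also have "\<sigma> (N p) Y = \<sigma> V Y"
      using Np V opens by (intro agree) (auto simp: Y_def)
    also have "\<sigma> V Y (restrict (restrict f (X \<inter> V)) Y) p = \<sigma> V (X \<inter> V) (restrict f (X \<inter> V)) p"
    proof (rule tangent_sheaf_restrict[of "\<sigma> V" C V])
      show "\<sigma> V \<in> carrier (tangent_sheaf C V)"
        using \<sigma> V by blast
    qed (use Np opens p f' in \<open>auto simp: Y_def\<close>)
    finally show ?thesis .
  qed
  have s: "s \<in> carrier (tangent_sheaf C (\<Union>\<U>))"
  proof (rule tangent_sheafI)
    show "s \<in> extensional (opens_within C (\<Union>\<U>))"
      by (simp add: s_def)
  next
    fix X assume X: "openin (zariski_on C) X" "X \<subseteq> \<Union>\<U>"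
    have der: "\<sigma> V (X \<inter> V) \<in> derivations C (X \<inter> V)" "openin (zariski_on C) (X \<inter> V)" if "V \<in> \<U>" for V
      using that \<sigma> op X by (auto intro: tangent_sheaf_derivation[of _ C V])
    have closed: "s X f \<in> regular_functions C X" if f: "f \<in> regular_functions C X" for f
    proof (rule regular_functions_local)
      fix p assume p: "p \<in> X"
      have Np: "N p \<in> \<U>" "p \<in> N p"
        using N[of p] X p by blast+
      have "restrict f (X \<inter> N p) \<in> regular_functions C (X \<inter> N p)"
        using Np der by (auto intro: regular_functions_restrict[OF f])
      then have reg: "\<sigma> (N p) (X \<inter> N p) (restrict f (X \<inter> N p)) \<in> regular_functions C (X \<inter> N p)"
        by (rule derivations_closed[OF der(1)[OF Np(1)]])
      have "restrict (s X f) (X \<inter> N p) = \<sigma> (N p) (X \<inter> N p) (restrict f (X \<inter> N p))"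
        by (rule extensionalityI[of _ "X \<inter> N p"])
          (use reg X f Np s_eq in \<open>auto dest: regular_functions_extensional\<close>)
      then show "\<exists>V. p \<in> V \<and> V \<subseteq> X \<and> restrict (s X f) V \<in> regular_functions C V"
        using reg p Np by (intro exI[of _ "X \<inter> N p"]) auto
    qed (use X f in \<open>simp add: s_def\<close>)
    show "s X \<in> derivations C X"
      unfolding derivations_iff[OF X(1)]
    proof (intro conjI ballI allI)
      show "s X \<in> regular_functions C X \<rightarrow>\<^sub>E regular_functions C X"
        using X closed by (auto simp: s_def)
    next
      fix f g p assume f: "f \<in> regular_functions C X" and g: "g \<in> regular_functions C X" and p: "p \<in> X"
      have Np: "N p \<in> \<U>" "p \<in> N p"
        using N[of p] X p by blast+
      define f' where "f' = restrict f (X \<inter> N p)"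
      define g' where "g' = restrict g (X \<inter> N p)"
      have f': "f' \<in> regular_functions C (X \<inter> N p)"
        using Np der by (auto simp: f'_def intro: regular_functions_restrict[OF f])
      have g': "g' \<in> regular_functions C (X \<inter> N p)"
        using Np der by (auto simp: g'_def intro: regular_functions_restrict[OF g])
      have sf: "s X f p = \<sigma> (N p) (X \<inter> N p) f' p" "f p = f' p"
        using s_eq[OF X f p Np(2,1)] p Np by (simp_all add: f'_def)
      have sg: "s X g p = \<sigma> (N p) (X \<inter> N p) g' p" "g p = g' p"
        using s_eq[OF X g p Np(2,1)] p Np by (simp_all add: g'_def)
      have "s X (\<lambda>p\<in>X. f p + g p) p
          = \<sigma> (N p) (X \<inter> N p) (restrict (\<lambda>p\<in>X. f p + g p) (X \<inter> N p)) p"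
        by (rule s_eq[OF X regular_functions_add[OF f g] p Np(2,1)])
      also have "restrict (\<lambda>p\<in>X. f p + g p) (X \<inter> N p) = (\<lambda>q\<in>X \<inter> N p. f' q + g' q)"
        by (auto simp: f'_def g'_def)
      also have "\<sigma> (N p) (X \<inter> N p) (\<lambda>q\<in>X \<inter> N p. f' q + g' q) p = \<sigma> (N p) (X \<inter> N p) f' p + \<sigma> (N p) (X \<inter> N p) g' p"
        by (rule derivations_add[OF der[OF Np(1)] f' g']) (use p Np in simp)
      finally show "s X (\<lambda>p\<in>X. f p + g p) p = s X f p + s X g p"
        by (simp only: sf sg)
      have "s X (\<lambda>p\<in>X. f p * g p) p
          = \<sigma> (N p) (X \<inter> N p) (restrict (\<lambda>p\<in>X. f p * g p) (X \<inter> N p)) p"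
        by (rule s_eq[OF X regular_functions_mult[OF f g] p Np(2,1)])
      also have "restrict (\<lambda>p\<in>X. f p * g p) (X \<inter> N p) = (\<lambda>q\<in>X \<inter> N p. f' q * g' q)"
        by (auto simp: f'_def g'_def)
      also have "\<sigma> (N p) (X \<inter> N p) (\<lambda>q\<in>X \<inter> N p. f' q * g' q) p = f' p * \<sigma> (N p) (X \<inter> N p) g' p + g' p * \<sigma> (N p) (X \<inter> N p) f' p"
        by (rule derivations_mult[OF der[OF Np(1)] f' g']) (use p Np in simp)
      finally show "s X (\<lambda>p\<in>X. f p * g p) p = f p * s X g p + g p * s X f p"
        by (simp only: sf sg)
    next
      fix c f p assume f: "f \<in> regular_functions C X" and p: "p \<in> X"
      have Np: "N p \<in> \<U>" "p \<in> N p"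
        using N[of p] X p by blast+
      define f' where "f' = restrict f (X \<inter> N p)"
      have f': "f' \<in> regular_functions C (X \<inter> N p)"
        using Np der by (auto simp: f'_def intro: regular_functions_restrict[OF f])
      have sf: "s X f p = \<sigma> (N p) (X \<inter> N p) f' p" "f p = f' p"
        using s_eq[OF X f p Np(2,1)] p Np by (simp_all add: f'_def)
      have "s X (\<lambda>p\<in>X. c * f p) p
          = \<sigma> (N p) (X \<inter> N p) (restrict (\<lambda>p\<in>X. c * f p) (X \<inter> N p)) p"
        by (rule s_eq[OF X regular_functions_scale[OF f] p Np(2,1)])
      also have "restrict (\<lambda>p\<in>X. c * f p) (X \<inter> N p) = (\<lambda>q\<in>X \<inter> N p. c * f' q)"
        by (auto simp: f'_def)
      also have "\<sigma> (N p) (X \<inter> N p) (\<lambda>q\<in>X \<inter> N p. c * f' q) p = c * \<sigma> (N p) (X \<inter> N p) f' p"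
        by (rule derivations_scale[OF der[OF Np(1)] f']) (use p Np in simp)
      finally show "s X (\<lambda>p\<in>X. c * f p) p = c * s X f p"
        by (simp only: sf)
    qed
  next
    fix X Y f p
    assume X: "openin (zariski_on C) X" "X \<subseteq> \<Union>\<U>" and Y: "openin (zariski_on C) Y" "Y \<subseteq> X"
      and f: "f \<in> regular_functions C X" and p: "p \<in> Y"
    have Np: "N p \<in> \<U>" "p \<in> N p"
      using N[of p] X Y p by blast+
    have opens: "openin (zariski_on C) (X \<inter> N p)" "openin (zariski_on C) (Y \<inter> N p)"
      using X Y Np op by auto
    have "s Y (restrict f Y) p = \<sigma> (N p) (Y \<inter> N p) (restrict (restrict f Y) (Y \<inter> N p)) p"
      using X Y p Np by (intro s_eq regular_functions_restrict[OF f]) auto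
    also have "restrict (restrict f Y) (Y \<inter> N p) = restrict (restrict f (X \<inter> N p)) (Y \<inter> N p)"
      using Y by (intro ext) (auto simp: restrict_def)
    also have "\<sigma> (N p) (Y \<inter> N p) (restrict (restrict f (X \<inter> N p)) (Y \<inter> N p)) p
        = \<sigma> (N p) (X \<inter> N p) (restrict f (X \<inter> N p)) p"
    proof (rule tangent_sheaf_restrict[of "\<sigma> (N p)" C "N p"])
      show "\<sigma> (N p) \<in> carrier (tangent_sheaf C (N p))"
        using \<sigma> Np by blast
      show "restrict f (X \<inter> N p) \<in> regular_functions C (X \<inter> N p)"
        using opens by (intro regular_functions_restrict[OF f]) auto
    qed (use Np opens p Y in auto)
    also have "\<dots> = s X f p"
      using X Y f p Np by (intro s_eq[symmetric]) auto
    finally show "s Y (restrict f Y) p = s X f p" .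
  qed
  have s_restrict: "restrict s (opens_within C V) = \<sigma> V" if V: "V \<in> \<U>" for V
  proof (rule tangent_sheaf_eqI)
    show "restrict s (opens_within C V) \<in> carrier (tangent_sheaf C V)"
      using V by (intro tangent_sheaf_restrict_closed[OF s]) auto
    show "\<sigma> V \<in> carrier (tangent_sheaf C V)"
      using \<sigma> V by blast
    fix X f p assume X: "openin (zariski_on C) X" "X \<subseteq> V" and f: "f \<in> regular_functions C X" and p: "p \<in> X"
    have "s X f p = \<sigma> V (X \<inter> V) (restrict f (X \<inter> V)) p"
      using X V f p by (intro s_eq) auto
    also have "X \<inter> V = X"
      using X by blast
    also have "restrict f X = f"
      by (simp add: extensional_restrict regular_functions_extensional[OF f])
    finally show "restrict s (opens_within C V) X f p = \<sigma> V X f p"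
      using X by simp
  qed
  have unique: "u = s" if u: "u \<in> carrier (tangent_sheaf C (\<Union>\<U>))"
    and restr: "\<forall>V\<in>\<U>. restrict u (opens_within C V) = \<sigma> V" for u
  proof (rule tangent_sheaf_eqI[OF u s])
    fix X f p assume X: "openin (zariski_on C) X" "X \<subseteq> \<Union>\<U>" and f: "f \<in> regular_functions C X" and p: "p \<in> X"
    have Np: "N p \<in> \<U>" "p \<in> N p"
      using N[of p] X p by blast+
    have op': "openin (zariski_on C) (X \<inter> N p)"
      using X Np op by auto
    have "u X f p = u (X \<inter> N p) (restrict f (X \<inter> N p)) p"
      using X f p Np op' by (intro tangent_sheaf_restrict[OF u, symmetric]) auto
    also have "\<dots> = restrict u (opens_within C (N p)) (X \<inter> N p) (restrict f (X \<inter> N p)) p"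
      using op' by simp
    also have "\<dots> = s X f p"
      using restr Np s_eq[OF X f p Np(2,1)] by simp
    finally show "u X f p = s X f p" .
  qed
  show "\<exists>!s. s \<in> carrier (tangent_sheaf C (\<Union>\<U>)) \<and> (\<forall>V\<in>\<U>. restrict s (opens_within C V) = \<sigma> V)"
  proof (rule ex1I[of _ s])
    show "s \<in> carrier (tangent_sheaf C (\<Union>\<U>)) \<and> (\<forall>V\<in>\<U>. restrict s (opens_within C V) = \<sigma> V)"
      using s s_restrict by simp
  qed (use unique in simp)
qed

lemma tangent_plus_structure_sheaf_is_sheaf:
  "sheaf_of_groups (zariski_on C) (tangent_plus_structure_sheaf C) (tangent_plus_structure_restrict C)"
proof -
  have eqs: "tangent_plus_structure_sheaf C = (\<lambda>U. tangent_sheaf C U \<times>\<times> add_monoid (\<O> C U))"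
    "tangent_plus_structure_restrict C = (\<lambda>U V (D, f). (restrict D (opens_within C V), restrict f V))"
    by (simp_all add: fun_eq_iff tangent_plus_structure_sheaf_def tangent_plus_structure_restrict_def)
  show ?thesis
    unfolding eqs by (rule product_sheaf_is_sheaf[OF tangent_sheaf_is_sheaf structure_sheaf_is_sheaf])
qed

section \<open>Automorphisms that are trivial modulo the highest power of t\<close>

definition constant_coeffs :: "'k pt set \<Rightarrow> ('k pt \<Rightarrow> complex) \<Rightarrow> 'k coeffs" where
  "constant_coeffs U h = (\<lambda>i. if i = 0 then h else (\<lambda>p\<in>U. 0))"

definition t_coeffs :: "'k pt set \<Rightarrow> 'k coeffs" where
  "t_coeffs U = (\<lambda>i. if i = 1 then (\<lambda>p\<in>U. 1) else (\<lambda>p\<in>U. 0))"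

text \<open>
  With \<open>N = n - 1\<close> these are the sections of the kernel of \<open>\<rho>\<^sub>n\<close> over proper open sets, see
  \<open>kernel_of_canonical_morphism\<close> below.
\<close>

definition top_order_automorphisms :: "('k::finite) pt set \<Rightarrow> nat \<Rightarrow> 'k pt set \<Rightarrow> 'k coeff_map set" where
  "top_order_automorphisms C N U = {\<phi> \<in> carrier (Aut_\<A> C (Suc N) U).
     \<forall>a \<in> carrier (\<A> C (Suc N) U). \<forall>i<N. \<phi> a i = a i}"

text \<open>
  This is \<open>a \<mapsto> a + t^N (D(a\<^sub>0) + a\<^sub>1 g)\<close>.
\<close>

definition top_order_map :: "('k::finite) pt set \<Rightarrow> nat \<Rightarrow> 'k pt set
    \<Rightarrow> (('k pt \<Rightarrow> complex) \<Rightarrow> ('k pt \<Rightarrow> complex)) \<Rightarrow> ('k pt \<Rightarrow> complex) \<Rightarrow> 'k coeff_map" where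
  "top_order_map C N U D g = (\<lambda>a \<in> carrier (\<A> C (Suc N) U). \<lambda>i.
     if i = N then (\<lambda>p\<in>U. a N p + (D (a 0) p + a 1 p * g p)) else a i)"

lemma sum_split_ends:
  fixes f :: "nat \<Rightarrow> 'a::comm_monoid_add"
  assumes "0 < N"
  shows "(\<Sum>j\<le>N. f j) = f 0 + (f N + (\<Sum>j\<in>{0<..<N}. f j))"
proof -
  have "{..N} = insert 0 (insert N {0<..<N})"
    using assms by auto
  then show ?thesis
    using assms by simp
qed

lemma A_mem_iff:
  "a \<in> carrier (\<A> C m U) \<longleftrightarrow>
    (\<forall>i<m. a i \<in> regular_functions C U) \<and> (\<forall>i\<ge>m. a i = (\<lambda>p\<in>U. 0))"
  by (simp add: \<A>_def)

lemma A_mult: "(a \<otimes>\<^bsub>\<A> C m U\<^esub> b) i =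
    (if i < m then (\<lambda>p\<in>U. \<Sum>j\<le>i. a j p * b (i - j) p) else (\<lambda>p\<in>U. 0))"
  by (simp add: \<A>_def)

lemma A_add: "(a \<oplus>\<^bsub>\<A> C m U\<^esub> b) i = (\<lambda>p\<in>U. a i p + b i p)"
  by (simp add: \<A>_def)

lemma A_smult: "(c \<odot>\<^bsub>\<A> C m U\<^esub> a) i = (\<lambda>p\<in>U. c * a i p)"
  by (simp add: \<A>_def)

lemma A_one: "\<one>\<^bsub>\<A> C m U\<^esub> i = (\<lambda>p\<in>U. if i = 0 \<and> i < m then 1 else 0)"
  by (simp add: \<A>_def)

lemma Aut_A_mem_iff:
  "\<phi> \<in> carrier (Aut_\<A> C m U) \<longleftrightarrow>
     \<phi> \<in> extensional (carrier (\<A> C m U)) \<and>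
     bij_betw \<phi> (carrier (\<A> C m U)) (carrier (\<A> C m U)) \<and>
     (\<forall>a \<in> carrier (\<A> C m U). \<forall>b \<in> carrier (\<A> C m U).
        \<phi> (a \<otimes>\<^bsub>\<A> C m U\<^esub> b) = \<phi> a \<otimes>\<^bsub>\<A> C m U\<^esub> \<phi> b \<and> \<phi> (a \<oplus>\<^bsub>\<A> C m U\<^esub> b) = \<phi> a \<oplus>\<^bsub>\<A> C m U\<^esub> \<phi> b) \<and>
     \<phi> \<one>\<^bsub>\<A> C m U\<^esub> = \<one>\<^bsub>\<A> C m U\<^esub> \<and>
     (\<forall>c. \<forall>a \<in> carrier (\<A> C m U). \<phi> (c \<odot>\<^bsub>\<A> C m U\<^esub> a) = c \<odot>\<^bsub>\<A> C m U\<^esub> \<phi> a) \<and>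
     (\<forall>a \<in> carrier (\<A> C m U). \<phi> a 0 = a 0)"
proof -
  have "\<phi> \<in> carrier (\<A> C m U) \<rightarrow> carrier (\<A> C m U)"
    if "bij_betw \<phi> (carrier (\<A> C m U)) (carrier (\<A> C m U))"
    using that by (rule bij_betw_imp_funcset)
  then show ?thesis
    unfolding Aut_\<A>_def Bij_def ring_iso_def ring_hom_def by auto
qed

context
  fixes C U :: "('k::finite) pt set" and N :: nat
  assumes U: "openin (zariski_on C) U" and N: "2 \<le> N"
begin

lemma A_coeff_regular: "a \<in> carrier (\<A> C m U) \<Longrightarrow> a i \<in> regular_functions C U"
  using regular_functions_const[OF U, of 0] by (cases "i < m") (auto simp: A_mem_iff)

lemma A_coeff_extensional: "a \<in> carrier (\<A> C m U) \<Longrightarrow> a i \<in> extensional U"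
  by (rule regular_functions_extensional[OF A_coeff_regular])

lemma A_eqI:
  assumes "a \<in> carrier (\<A> C m U)" "b \<in> carrier (\<A> C m U)"
    and "\<And>i p. i < m \<Longrightarrow> p \<in> U \<Longrightarrow> a i p = b i p"
  shows "a = b"
proof
  fix i
  show "a i = b i"
  proof (cases "i < m")
    case True
    then show ?thesis
      using assms by (intro extensionalityI[of _ U]) (auto intro: A_coeff_extensional)
  qed (use assms in \<open>simp add: A_mem_iff\<close>)
qed

lemma A_mult_closed:
  assumes "a \<in> carrier (\<A> C m U)" "b \<in> carrier (\<A> C m U)"
  shows "a \<otimes>\<^bsub>\<A> C m U\<^esub> b \<in> carrier (\<A> C m U)"
proof -
  have "(\<lambda>p\<in>U. \<Sum>j\<le>i. (\<lambda>p\<in>U. a j p * b (i - j) p) p) \<in> regular_functions C U" for i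
    using assms by (intro regular_functions_sum U regular_functions_mult A_coeff_regular) auto
  then show ?thesis
    by (simp add: A_mem_iff A_mult cong: restrict_cong)
qed

lemma A_add_closed:
  "a \<in> carrier (\<A> C m U) \<Longrightarrow> b \<in> carrier (\<A> C m U) \<Longrightarrow> a \<oplus>\<^bsub>\<A> C m U\<^esub> b \<in> carrier (\<A> C m U)"
  using regular_functions_add[OF A_coeff_regular A_coeff_regular, of a m b m]
  by (auto simp: A_mem_iff A_add)

lemma A_smult_closed:
  "a \<in> carrier (\<A> C m U) \<Longrightarrow> c \<odot>\<^bsub>\<A> C m U\<^esub> a \<in> carrier (\<A> C m U)"
  using regular_functions_scale[OF A_coeff_regular, of a m c] by (auto simp: A_mem_iff A_smult)

lemma A_one_closed: "\<one>\<^bsub>\<A> C m U\<^esub> \<in> carrier (\<A> C m U)"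
  using regular_functions_const[OF U] by (simp add: A_mem_iff A_one)

lemma constant_coeffs_closed:
  "h \<in> regular_functions C U \<Longrightarrow> constant_coeffs U h \<in> carrier (\<A> C (Suc N) U)"
  using regular_functions_const[OF U] by (simp add: A_mem_iff constant_coeffs_def)

lemma t_coeffs_closed: "t_coeffs U \<in> carrier (\<A> C (Suc N) U)"
  using regular_functions_const[OF U] N by (auto simp: A_mem_iff t_coeffs_def)

context
  fixes \<phi> assumes \<phi>: "\<phi> \<in> top_order_automorphisms C N U"
begin

lemma top_order_closed: "a \<in> carrier (\<A> C (Suc N) U) \<Longrightarrow> \<phi> a \<in> carrier (\<A> C (Suc N) U)"
  using \<phi> by (auto simp: top_order_automorphisms_def Aut_A_mem_iff bij_betw_def)

lemma top_order_low: "a \<in> carrier (\<A> C (Suc N) U) \<Longrightarrow> i < N \<Longrightarrow> \<phi> a i = a i"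
  using \<phi> by (auto simp: top_order_automorphisms_def)

lemma top_order_add:
  "a \<in> carrier (\<A> C (Suc N) U) \<Longrightarrow> b \<in> carrier (\<A> C (Suc N) U) \<Longrightarrow> p \<in> U
    \<Longrightarrow> \<phi> (a \<oplus>\<^bsub>\<A> C (Suc N) U\<^esub> b) N p = \<phi> a N p + \<phi> b N p"
  using \<phi> by (simp add: top_order_automorphisms_def Aut_A_mem_iff A_add)

lemma top_order_smult:
  "a \<in> carrier (\<A> C (Suc N) U) \<Longrightarrow> p \<in> U \<Longrightarrow> \<phi> (c \<odot>\<^bsub>\<A> C (Suc N) U\<^esub> a) N p = c * \<phi> a N p"
  using \<phi> by (simp add: top_order_automorphisms_def Aut_A_mem_iff A_smult)

text \<open>
  For \<open>\<delta>(a) = (\<phi>(a) - a)\<^sub>N\<close> this is the rule \<open>\<delta>(a b) = a\<^sub>0 \<delta>(b) + b\<^sub>0 \<delta>(a)\<close>: in the convolution that gives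
  the coefficient of \<open>t^N\<close>, only the two extreme terms involve a coefficient changed by \<open>\<phi>\<close>.
\<close>

lemma top_order_mult:
  assumes a: "a \<in> carrier (\<A> C (Suc N) U)" and b: "b \<in> carrier (\<A> C (Suc N) U)" and p: "p \<in> U"
  shows "\<phi> (a \<otimes>\<^bsub>\<A> C (Suc N) U\<^esub> b) N p = (a \<otimes>\<^bsub>\<A> C (Suc N) U\<^esub> b) N p
    + a 0 p * (\<phi> b N p - b N p) + b 0 p * (\<phi> a N p - a N p)"
proof -
  have "\<phi> (a \<otimes>\<^bsub>\<A> C (Suc N) U\<^esub> b) = \<phi> a \<otimes>\<^bsub>\<A> C (Suc N) U\<^esub> \<phi> b"
    using \<phi> a b by (simp add: top_order_automorphisms_def Aut_A_mem_iff)
  then have "\<phi> (a \<otimes>\<^bsub>\<A> C (Suc N) U\<^esub> b) N p = (\<Sum>j\<le>N. \<phi> a j p * \<phi> b (N - j) p)"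
    using p by (simp add: A_mult)
  also have "\<dots> = a 0 p * \<phi> b N p + (\<phi> a N p * b 0 p + (\<Sum>j\<in>{0<..<N}. a j p * b (N - j) p))"
    using N top_order_low[OF a] top_order_low[OF b] by (simp add: sum_split_ends)
  also have "(\<Sum>j\<in>{0<..<N}. a j p * b (N - j) p) =
      (a \<otimes>\<^bsub>\<A> C (Suc N) U\<^esub> b) N p - a 0 p * b N p - a N p * b 0 p"
    using N p by (simp add: A_mult sum_split_ends)
  finally show ?thesis
    by (simp add: algebra_simps)
qed

text \<open>
  Write \<open>a = a\<^sub>0 + t s\<close> and apply the preceding rule to \<open>t s\<close>: since \<open>t\<close> has constant term 0 and \<open>s\<close> has
  constant term \<open>a\<^sub>1\<close>, its increment is \<open>a\<^sub>1\<close> times that of \<open>t\<close>.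
\<close>

lemma top_order_formula:
  assumes a: "a \<in> carrier (\<A> C (Suc N) U)" and p: "p \<in> U"
  shows "\<phi> a N p = a N p + (\<phi> (constant_coeffs U (a 0)) N p + a 1 p * \<phi> (t_coeffs U) N p)"
proof -
  let ?c = "constant_coeffs U (a 0)" and ?t = "t_coeffs U"
  define s where "s = (\<lambda>i. if i < N then a (Suc i) else (\<lambda>p\<in>U. 0))"
  have c: "?c \<in> carrier (\<A> C (Suc N) U)"
    using a by (intro constant_coeffs_closed A_coeff_regular)
  have s: "s \<in> carrier (\<A> C (Suc N) U)"
    using A_coeff_regular[OF a] regular_functions_const[OF U, of 0] by (auto simp: A_mem_iff s_def)
  have ts: "?t \<otimes>\<^bsub>\<A> C (Suc N) U\<^esub> s \<in> carrier (\<A> C (Suc N) U)"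
    using t_coeffs_closed s by (rule A_mult_closed)
  have ts_eq: "(?t \<otimes>\<^bsub>\<A> C (Suc N) U\<^esub> s) i p = (if i = 0 then 0 else a i p)"
    if "i < Suc N" "p \<in> U" for i p
  proof -
    have "(?t \<otimes>\<^bsub>\<A> C (Suc N) U\<^esub> s) i p = (\<Sum>j\<le>i. ?t j p * s (i - j) p)"
      using that by (simp add: A_mult)
    also have "\<dots> = (\<Sum>j\<le>i. if j = 1 then s (i - 1) p else 0)"
      by (rule sum.cong) (use that in \<open>auto simp: t_coeffs_def\<close>)
    also have "\<dots> = (if i = 0 then 0 else a i p)"
      using that by (auto simp: s_def)
    finally show ?thesis .
  qed
  have a_eq: "a = ?c \<oplus>\<^bsub>\<A> C (Suc N) U\<^esub> (?t \<otimes>\<^bsub>\<A> C (Suc N) U\<^esub> s)"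
    by (rule A_eqI[OF a A_add_closed[OF c ts]]) (auto simp: A_add ts_eq constant_coeffs_def)
  have "\<phi> a N p = \<phi> ?c N p + \<phi> (?t \<otimes>\<^bsub>\<A> C (Suc N) U\<^esub> s) N p"
    using top_order_add[OF c ts p] by (simp only: a_eq[symmetric])
  also have "\<phi> (?t \<otimes>\<^bsub>\<A> C (Suc N) U\<^esub> s) N p = a N p + a 1 p * \<phi> ?t N p"
    using top_order_mult[OF t_coeffs_closed s p] N p by (simp add: ts_eq) (simp add: s_def t_coeffs_def)
  finally show ?thesis
    by simp
qed

lemma top_order_derivation:
  "(\<lambda>h \<in> regular_functions C U. \<phi> (constant_coeffs U h) N) \<in> derivations C U"
  unfolding derivations_iff[OF U]
proof (intro conjI ballI allI)
  note c = constant_coeffs_closed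
  show "(\<lambda>h \<in> regular_functions C U. \<phi> (constant_coeffs U h) N)
      \<in> regular_functions C U \<rightarrow>\<^sub>E regular_functions C U"
    by (auto intro: A_coeff_regular top_order_closed c)
  fix f p assume f: "f \<in> regular_functions C U" and p: "p \<in> U"
  show "(\<lambda>h \<in> regular_functions C U. \<phi> (constant_coeffs U h) N) (\<lambda>p\<in>U. k * f p) p
      = k * (\<lambda>h \<in> regular_functions C U. \<phi> (constant_coeffs U h) N) f p" for k
  proof -
    have reg: "(\<lambda>p\<in>U. k * f p) \<in> regular_functions C U"
      by (rule regular_functions_scale[OF f])
    have eq: "constant_coeffs U (\<lambda>p\<in>U. k * f p) = k \<odot>\<^bsub>\<A> C (Suc N) U\<^esub> constant_coeffs U f"
      by (rule A_eqI[OF c[OF reg] A_smult_closed[OF c[OF f]]]) (simp add: A_smult constant_coeffs_def)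
    show ?thesis
      using top_order_smult[OF c[OF f] p, of k] f reg by (simp add: eq)
  qed
  fix g assume g: "g \<in> regular_functions C U"
  show "(\<lambda>h \<in> regular_functions C U. \<phi> (constant_coeffs U h) N) (\<lambda>p\<in>U. f p + g p) p
      = (\<lambda>h \<in> regular_functions C U. \<phi> (constant_coeffs U h) N) f p
      + (\<lambda>h \<in> regular_functions C U. \<phi> (constant_coeffs U h) N) g p"
  proof -
    have reg: "(\<lambda>p\<in>U. f p + g p) \<in> regular_functions C U"
      by (rule regular_functions_add[OF f g])
    have eq: "constant_coeffs U (\<lambda>p\<in>U. f p + g p)
        = constant_coeffs U f \<oplus>\<^bsub>\<A> C (Suc N) U\<^esub> constant_coeffs U g"
      by (rule A_eqI[OF c[OF reg] A_add_closed[OF c[OF f] c[OF g]]])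
        (simp add: A_add constant_coeffs_def)
    show ?thesis
      using top_order_add[OF c[OF f] c[OF g] p] f g reg by (simp add: eq)
  qed
  show "(\<lambda>h \<in> regular_functions C U. \<phi> (constant_coeffs U h) N) (\<lambda>p\<in>U. f p * g p) p
      = f p * (\<lambda>h \<in> regular_functions C U. \<phi> (constant_coeffs U h) N) g p
      + g p * (\<lambda>h \<in> regular_functions C U. \<phi> (constant_coeffs U h) N) f p"
  proof -
    have reg: "(\<lambda>p\<in>U. f p * g p) \<in> regular_functions C U"
      by (rule regular_functions_mult[OF f g])
    have "(constant_coeffs U f \<otimes>\<^bsub>\<A> C (Suc N) U\<^esub> constant_coeffs U g) i p
        = constant_coeffs U (\<lambda>p\<in>U. f p * g p) i p" if "i < Suc N" "p \<in> U" for i p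
    proof -
      have "(constant_coeffs U f \<otimes>\<^bsub>\<A> C (Suc N) U\<^esub> constant_coeffs U g) i p
          = (\<Sum>j\<le>i. constant_coeffs U f j p * constant_coeffs U g (i - j) p)"
        using that by (simp add: A_mult)
      also have "\<dots> = (\<Sum>j\<le>i. if j = 0 then f p * constant_coeffs U g i p else 0)"
        by (rule sum.cong) (use that in \<open>auto simp: constant_coeffs_def\<close>)
      finally show ?thesis
        using that by (auto simp: constant_coeffs_def)
    qed
    then have eq: "constant_coeffs U (\<lambda>p\<in>U. f p * g p)
        = constant_coeffs U f \<otimes>\<^bsub>\<A> C (Suc N) U\<^esub> constant_coeffs U g"
      by (intro A_eqI[OF c[OF reg] A_mult_closed[OF c[OF f] c[OF g]]]) simp
    have zero: "constant_coeffs U h N p = 0" for h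
      using p N by (simp add: constant_coeffs_def)
    have first: "constant_coeffs U h 0 = h" for h
      by (simp add: constant_coeffs_def)
    show ?thesis
      using top_order_mult[OF c[OF f] c[OF g] p] f g reg
      by (simp add: eq[symmetric] zero first)
  qed
qed

end

lemma top_order_eqI:
  assumes \<phi>: "\<phi> \<in> top_order_automorphisms C N U" and \<psi>: "\<psi> \<in> top_order_automorphisms C N U"
    and const: "\<And>h. h \<in> regular_functions C U \<Longrightarrow> \<phi> (constant_coeffs U h) N = \<psi> (constant_coeffs U h) N"
    and t: "\<phi> (t_coeffs U) N = \<psi> (t_coeffs U) N"
  shows "\<phi> = \<psi>"
proof (rule extensionalityI[of _ "carrier (\<A> C (Suc N) U)"])
  fix a assume a: "a \<in> carrier (\<A> C (Suc N) U)"
  show "\<phi> a = \<psi> a"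
  proof (rule A_eqI[OF top_order_closed[OF \<phi> a] top_order_closed[OF \<psi> a]])
    fix i p assume "i < Suc N" and p: "p \<in> U"
    then consider "i < N" | "i = N"
      by linarith
    then show "\<phi> a i p = \<psi> a i p"
    proof cases
      case 1
      then show ?thesis
        by (simp add: top_order_low[OF \<phi> a] top_order_low[OF \<psi> a])
    next
      case 2
      then show ?thesis
        using const[OF A_coeff_regular[OF a, of 0]] t
        by (simp add: top_order_formula[OF \<phi> a p] top_order_formula[OF \<psi> a p])
    qed
  qed
qed (use \<phi> \<psi> in \<open>simp_all add: top_order_automorphisms_def Aut_A_mem_iff\<close>)

text \<open>
  Because \<open>N \<ge> 2\<close>, \<open>\<psi> a\<close> has the same coefficients as \<open>a\<close> in degrees 0 and 1, and the
  increment of \<open>\<phi>\<close> depends only on those. Hence increments add up.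
\<close>

lemma top_order_compose:
  assumes \<phi>: "\<phi> \<in> top_order_automorphisms C N U" and \<psi>: "\<psi> \<in> top_order_automorphisms C N U"
    and a: "a \<in> carrier (\<A> C (Suc N) U)" and p: "p \<in> U"
  shows "(\<phi> \<otimes>\<^bsub>Aut_\<A> C (Suc N) U\<^esub> \<psi>) a N p
    = \<psi> a N p + (\<phi> (constant_coeffs U (a 0)) N p + a 1 p * \<phi> (t_coeffs U) N p)"
proof -
  have "(\<phi> \<otimes>\<^bsub>Aut_\<A> C (Suc N) U\<^esub> \<psi>) a = \<phi> (\<psi> a)"
    using \<phi> \<psi> a
    by (simp add: top_order_automorphisms_def Aut_\<A>_def BijGroup_def compose_def)
  then show ?thesis
    using top_order_formula[OF \<phi> top_order_closed[OF \<psi> a] p] N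
    by (simp add: top_order_low[OF \<psi> a])
qed

context
  fixes D g
  assumes D: "D \<in> derivations C U" and g: "g \<in> regular_functions C U"
begin

lemma top_order_map_apply:
  "a \<in> carrier (\<A> C (Suc N) U) \<Longrightarrow> p \<in> U \<Longrightarrow>
    top_order_map C N U D g a i p = (if i = N then a N p + (D (a 0) p + a 1 p * g p) else a i p)"
  by (simp add: top_order_map_def)

lemma top_order_increment_regular:
  assumes "a \<in> carrier (\<A> C (Suc N) U)"
  shows "(\<lambda>p\<in>U. D (a 0) p + a 1 p * g p) \<in> regular_functions C U"
proof -
  have "(\<lambda>p\<in>U. D (a 0) p + (\<lambda>p\<in>U. a 1 p * g p) p) \<in> regular_functions C U"
    using assms by (intro regular_functions_add regular_functions_mult derivations_closed[OF D] g A_coeff_regular)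
  then show ?thesis
    by (simp cong: restrict_cong)
qed

lemma top_order_map_closed:
  assumes a: "a \<in> carrier (\<A> C (Suc N) U)"
  shows "top_order_map C N U D g a \<in> carrier (\<A> C (Suc N) U)"
proof -
  have "(\<lambda>p\<in>U. a N p + (\<lambda>p\<in>U. D (a 0) p + a 1 p * g p) p) \<in> regular_functions C U"
    by (intro regular_functions_add A_coeff_regular[OF a] top_order_increment_regular[OF a])
  then show ?thesis
    using a by (auto simp: A_mem_iff top_order_map_def cong: restrict_cong)
qed

text \<open>
  The increment \<open>D(a\<^sub>0) + a\<^sub>1 g\<close> depends only on coefficients that the map leaves unchanged, so it can be
  subtracted again.
\<close>

lemma top_order_map_bij:
  "bij_betw (top_order_map C N U D g) (carrier (\<A> C (Suc N) U)) (carrier (\<A> C (Suc N) U))"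
proof (rule bij_betw_imageI)
  show "inj_on (top_order_map C N U D g) (carrier (\<A> C (Suc N) U))"
  proof (rule inj_onI)
    fix a b
    assume a: "a \<in> carrier (\<A> C (Suc N) U)" and b: "b \<in> carrier (\<A> C (Suc N) U)"
      and eq: "top_order_map C N U D g a = top_order_map C N U D g b"
    have low: "a i = b i" if "i \<noteq> N" for i
      using fun_cong[OF eq, of i] that a b by (simp add: top_order_map_def)
    have "a N p = b N p" if p: "p \<in> U" for p
      using fun_cong[OF fun_cong[OF eq, of N], of p] low[of 0] low[of 1] N
      by (simp add: top_order_map_apply[OF a p] top_order_map_apply[OF b p])
    then show "a = b"
      using low by (intro A_eqI[OF a b]) metis
  qed
  have "b \<in> top_order_map C N U D g ` carrier (\<A> C (Suc N) U)" if b: "b \<in> carrier (\<A> C (Suc N) U)" for b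
  proof -
    \<comment> \<open>The factor \<open>-1\<close> and the inner restrictions match the closure lemmas for regular functions.\<close>
    define a where "a = b(N := (\<lambda>p\<in>U. b N p + (\<lambda>p\<in>U. -1 * (\<lambda>p\<in>U. D (b 0) p + b 1 p * g p) p) p))"
    have "a N \<in> regular_functions C U"
      unfolding a_def fun_upd_same
      by (intro regular_functions_add regular_functions_scale A_coeff_regular[OF b]
          top_order_increment_regular[OF b])
    then have a: "a \<in> carrier (\<A> C (Suc N) U)"
      using b by (auto simp: A_mem_iff a_def)
    have "top_order_map C N U D g a = b"
    proof (rule A_eqI[OF top_order_map_closed[OF a] b])
      fix i p assume p: "p \<in> U"
      then show "top_order_map C N U D g a i p = b i p"
        using N by (simp add: top_order_map_apply[OF a p]) (simp add: a_def)
    qed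
    then show ?thesis
      using a by blast
  qed
  then show "top_order_map C N U D g ` carrier (\<A> C (Suc N) U) = carrier (\<A> C (Suc N) U)"
    using top_order_map_closed by blast
qed

lemma top_order_map_mult:
  assumes a: "a \<in> carrier (\<A> C (Suc N) U)" and b: "b \<in> carrier (\<A> C (Suc N) U)"
  shows "top_order_map C N U D g (a \<otimes>\<^bsub>\<A> C (Suc N) U\<^esub> b)
    = top_order_map C N U D g a \<otimes>\<^bsub>\<A> C (Suc N) U\<^esub> top_order_map C N U D g b"
    (is "?F (a \<otimes>\<^bsub>?A\<^esub> b) = _")
proof (rule A_eqI[OF top_order_map_closed[OF A_mult_closed[OF a b]]
      A_mult_closed[OF top_order_map_closed[OF a] top_order_map_closed[OF b]]])
  fix i p assume i: "i < Suc N" and p: "p \<in> U"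
  note F = top_order_map_apply[OF a p] top_order_map_apply[OF b p]
  have prod: "(?F a \<otimes>\<^bsub>?A\<^esub> ?F b) i p = (\<Sum>j\<le>i. ?F a j p * ?F b (i - j) p)"
    using i p by (simp add: A_mult)
  show "?F (a \<otimes>\<^bsub>?A\<^esub> b) i p = (?F a \<otimes>\<^bsub>?A\<^esub> ?F b) i p"
  proof (cases "i = N")
    case False
    then have "(\<Sum>j\<le>i. ?F a j p * ?F b (i - j) p) = (\<Sum>j\<le>i. a j p * b (i - j) p)"
      using i by (intro sum.cong) (auto simp: F)
    then show ?thesis
      using False i p
      by (simp add: prod top_order_map_apply[OF A_mult_closed[OF a b] p]) (simp add: A_mult)
  next
    case True
    have ab0: "(a \<otimes>\<^bsub>?A\<^esub> b) 0 = (\<lambda>p\<in>U. a 0 p * b 0 p)"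
      by (simp add: A_mult)
    have ab1: "(a \<otimes>\<^bsub>?A\<^esub> b) 1 p = a 0 p * b 1 p + a 1 p * b 0 p"
      using N p by (simp add: A_mult)
    have mid: "(\<Sum>j\<in>{0<..<N}. ?F a j p * ?F b (N - j) p) = (\<Sum>j\<in>{0<..<N}. a j p * b (N - j) p)"
      by (intro sum.cong) (auto simp: F)
    have ab_top: "(a \<otimes>\<^bsub>?A\<^esub> b) N p
        = a 0 p * b N p + (a N p * b 0 p + (\<Sum>j\<in>{0<..<N}. a j p * b (N - j) p))"
      using N p by (simp add: A_mult sum_split_ends)
    have leibniz: "D (\<lambda>p\<in>U. a 0 p * b 0 p) p = a 0 p * D (b 0) p + b 0 p * D (a 0) p"
      by (rule derivations_mult[OF D U A_coeff_regular[OF a] A_coeff_regular[OF b] p])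
    have "?F (a \<otimes>\<^bsub>?A\<^esub> b) N p = (a \<otimes>\<^bsub>?A\<^esub> b) N p + (a 0 p * D (b 0) p + b 0 p * D (a 0) p
        + (a 0 p * b 1 p + a 1 p * b 0 p) * g p)"
      by (simp only: top_order_map_apply[OF A_mult_closed[OF a b] p] ab0 ab1 leibniz simp_thms if_True)
    moreover have "(?F a \<otimes>\<^bsub>?A\<^esub> ?F b) N p = ?F a 0 p * ?F b N p
        + (?F a N p * ?F b 0 p + (\<Sum>j\<in>{0<..<N}. ?F a j p * ?F b (N - j) p))"
      using prod True N by (simp add: sum_split_ends)
    moreover have "?F a 0 p = a 0 p" "?F b 0 p = b 0 p"
      "?F a N p = a N p + (D (a 0) p + a 1 p * g p)" "?F b N p = b N p + (D (b 0) p + b 1 p * g p)"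
      using N by (simp_all add: F)
    ultimately show ?thesis
      by (simp only: True mid ab_top) (simp add: algebra_simps)
  qed
qed

lemma top_order_map_one: "top_order_map C N U D g \<one>\<^bsub>\<A> C (Suc N) U\<^esub> = \<one>\<^bsub>\<A> C (Suc N) U\<^esub>"
proof (rule A_eqI[OF top_order_map_closed[OF A_one_closed] A_one_closed])
  fix i p assume p: "p \<in> U"
  have "D (\<lambda>p\<in>U. 1) p = 0"
  proof -
    have "(\<lambda>p\<in>U. (\<lambda>p\<in>U. 1) p * (\<lambda>p\<in>U. 1) p) = (\<lambda>p\<in>U. 1 :: complex)"
      by auto
    then show ?thesis
      using derivations_mult[OF D U regular_functions_const[OF U, of 1] regular_functions_const[OF U, of 1] p] p
      by simp
  qed
  then show "top_order_map C N U D g \<one>\<^bsub>\<A> C (Suc N) U\<^esub> i p = \<one>\<^bsub>\<A> C (Suc N) U\<^esub> i p"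
    using p N by (simp add: top_order_map_apply[OF A_one_closed p] A_one)
qed

lemma top_order_map_in: "top_order_map C N U D g \<in> top_order_automorphisms C N U"
proof -
  let ?F = "top_order_map C N U D g" and ?A = "\<A> C (Suc N) U"
  have add: "?F (a \<oplus>\<^bsub>?A\<^esub> b) = ?F a \<oplus>\<^bsub>?A\<^esub> ?F b" if a: "a \<in> carrier ?A" and b: "b \<in> carrier ?A" for a b
  proof (rule A_eqI[OF top_order_map_closed[OF A_add_closed[OF a b]]
        A_add_closed[OF top_order_map_closed[OF a] top_order_map_closed[OF b]]])
    fix i p assume p: "p \<in> U"
    have "D (\<lambda>p\<in>U. a 0 p + b 0 p) p = D (a 0) p + D (b 0) p"
      by (rule derivations_add[OF D U A_coeff_regular[OF a] A_coeff_regular[OF b] p])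
    then show "?F (a \<oplus>\<^bsub>?A\<^esub> b) i p = (?F a \<oplus>\<^bsub>?A\<^esub> ?F b) i p"
      using p by (simp add: A_add top_order_map_apply[OF A_add_closed[OF a b] p]
          top_order_map_apply[OF a p] top_order_map_apply[OF b p] algebra_simps)
  qed
  have smult: "?F (c \<odot>\<^bsub>?A\<^esub> a) = c \<odot>\<^bsub>?A\<^esub> ?F a" if a: "a \<in> carrier ?A" for c a
  proof (rule A_eqI[OF top_order_map_closed[OF A_smult_closed[OF a]]
        A_smult_closed[OF top_order_map_closed[OF a]]])
    fix i p assume p: "p \<in> U"
    have "D (\<lambda>p\<in>U. c * a 0 p) p = c * D (a 0) p"
      by (rule derivations_scale[OF D U A_coeff_regular[OF a] p])
    then show "?F (c \<odot>\<^bsub>?A\<^esub> a) i p = (c \<odot>\<^bsub>?A\<^esub> ?F a) i p"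
      using p by (simp add: A_smult top_order_map_apply[OF A_smult_closed[OF a] p]
          top_order_map_apply[OF a p] algebra_simps)
  qed
  have low: "?F a i = a i" if "a \<in> carrier ?A" "i < N" for a i
    using that by (simp add: top_order_map_def)
  have "?F \<in> extensional (carrier ?A)"
    by (simp add: top_order_map_def)
  then show ?thesis
    using top_order_map_bij top_order_map_mult top_order_map_one add smult low N
    by (simp add: top_order_automorphisms_def Aut_A_mem_iff)
qed

lemma top_order_map_constant:
  assumes h: "h \<in> regular_functions C U"
  shows "top_order_map C N U D g (constant_coeffs U h) N = D h"
proof (rule extensionalityI[of _ U])
  show "top_order_map C N U D g (constant_coeffs U h) N \<in> extensional U"
    by (rule A_coeff_extensional[OF top_order_map_closed[OF constant_coeffs_closed[OF h]]])
  show "D h \<in> extensional U"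
    by (rule regular_functions_extensional[OF derivations_closed[OF D h]])
  fix p assume p: "p \<in> U"
  then show "top_order_map C N U D g (constant_coeffs U h) N p = D h p"
    using N by (simp add: top_order_map_apply[OF constant_coeffs_closed[OF h] p])
      (simp add: constant_coeffs_def)
qed

lemma top_order_map_t: "top_order_map C N U D g (t_coeffs U) N = g"
proof (rule extensionalityI[of _ U])
  show "top_order_map C N U D g (t_coeffs U) N \<in> extensional U"
    by (rule A_coeff_extensional[OF top_order_map_closed[OF t_coeffs_closed]])
  show "g \<in> extensional U"
    by (rule regular_functions_extensional[OF g])
  fix p assume p: "p \<in> U"
  have "(\<lambda>p\<in>U. 0 * (\<lambda>p\<in>U. 0 :: complex) p) = (\<lambda>p\<in>U. 0)"
    by auto
  then have "D (\<lambda>p\<in>U. 0) p = 0"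
    using derivations_scale[OF D U regular_functions_const[OF U, of 0] p, of 0] by simp
  then show "top_order_map C N U D g (t_coeffs U) N p = g p"
    using N p by (simp add: top_order_map_apply[OF t_coeffs_closed p]) (simp add: t_coeffs_def)
qed

end

end

section \<open>Affine charts\<close>

lemma topspace_zariski_subset: "topspace zariski \<subseteq> (proj_space :: ('k::finite) pt set)"
  by (auto simp: zariski_def topology_generated_by_topspace nonvanishing_locus_def)

lemma openin_zariski_on_nonvanishing_locus:
  "homogeneous_form d F \<Longrightarrow> openin (zariski_on C) (C \<inter> nonvanishing_locus F)"
  unfolding zariski_def by (intro openin_subtopology_Int2 topology_generated_by_Basis) blast

lemma proj_space_member:
  assumes "v \<noteq> 0" "u \<in> vec.span {v} - {0}"
  obtains c where "c \<noteq> 0" "u = c *s v"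
  using assms by (auto simp: vec.span_singleton)

lemma nonvanishing_locus_iff:
  assumes F: "homogeneous_form d F" and v: "v \<noteq> 0"
  shows "vec.span {v} \<in> nonvanishing_locus F \<longleftrightarrow> F v \<noteq> 0"
proof -
  have "F u \<noteq> 0" if "F v \<noteq> 0" and u: "u \<in> vec.span {v} - {0}" for u
    using that(1) proj_space_member[OF v u] homogeneous_form_scaling[OF F] by (metis mult_eq_0_iff power_not_zero)
  moreover have "v \<in> vec.span {v} - {0}"
    using v vec.span_base[of v "{v}"] by simp
  moreover have "vec.span {v} \<in> proj_space"
    using v by (auto simp: proj_space_def)
  ultimately show ?thesis
    unfolding nonvanishing_locus_def by blast
qed

text \<open>
  If \<open>w\<close> spans \<open>q\<close>, some 2 by 2 minor of the matrix with rows \<open>w\<close> and \<open>u\<close>, viewed as a linear form in \<open>u\<close>,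
  does not vanish on \<open>p\<close>; otherwise \<open>p\<close> and \<open>q\<close> would be the same line.
\<close>

lemma separating_linear_form:
  fixes p q :: "('k::finite) pt"
  assumes p: "p \<in> proj_space" and q: "q \<in> proj_space" and "p \<noteq> q"
  obtains F where "homogeneous_form 1 F" "p \<in> nonvanishing_locus F" "q \<notin> nonvanishing_locus F"
proof -
  obtain v where v: "v \<noteq> 0" "p = vec.span {v}"
    using p by (auto simp: proj_space_def)
  obtain w where w: "w \<noteq> 0" "q = vec.span {w}"
    using q by (auto simp: proj_space_def)
  obtain k where k: "w $ k \<noteq> 0"
    using w by (metis vec_eq_iff zero_index)
  have "\<exists>j. w $ j * v $ k - w $ k * v $ j \<noteq> 0"
  proof (rule ccontr)
    assume "\<nexists>j. w $ j * v $ k - w $ k * v $ j \<noteq> 0"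
    then have eq: "v = (v $ k / w $ k) *s w"
      using k by (simp add: vec_eq_iff field_simps)
    then have "v $ k / w $ k \<noteq> 0"
      using v by (metis vec.scale_zero_left)
    then have "vec.span {(v $ k / w $ k) *s w} = vec.span {w}"
      using vec.span_image_scale[of "{w}" "\<lambda>_. v $ k / w $ k"] by simp
    then show False
      using eq v w \<open>p \<noteq> q\<close> by metis
  qed
  then obtain j where j: "w $ j * v $ k - w $ k * v $ j \<noteq> 0"
    by blast
  let ?F = "\<lambda>u. w $ j * u $ k + (- (w $ k)) * u $ j"
  have F: "homogeneous_form 1 ?F"
    by (intro homogeneous_form_add homogeneous_form_scale homogeneous_form_coordinate)
  show ?thesis
    using that[OF F] nonvanishing_locus_iff[OF F] v w j by simp
qed

text \<open>
  These sets serve as the basis: over proper open sets the sections of the sheaves of automorphisms are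
  explicit, and inside a coordinate chart regular functions have enough denominators.
\<close>

definition chart_opens :: "('k::finite) pt set \<Rightarrow> 'k pt set set" where
  "chart_opens C = {V. openin (zariski_on C) V \<and> V \<noteq> C \<and> (\<exists>i. V \<subseteq> nonvanishing_locus (\<lambda>v. v $ i))}"

text \<open>
  A strict inclusion of nonempty irreducible closed sets exhibits two different points.
\<close>

lemma two_points_if_dimension_one:
  assumes "krull_dim (zariski_on C) = 1"
  shows "\<exists>x\<in>C. \<exists>y\<in>C. x \<noteq> y"
proof -
  let ?S = "{enat k | k. \<exists>Z. (\<forall>i\<le>k. closedin (zariski_on C) (Z i) \<and> irreducible_in (zariski_on C) (Z i))
      \<and> (\<forall>i<k. Z i \<subset> Z (Suc i))}"
  have "0 < Sup ?S"
    using assms by (simp add: krull_dim_def)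
  then obtain k Z where Z: "\<forall>i\<le>k. closedin (zariski_on C) (Z i) \<and> irreducible_in (zariski_on C) (Z i)"
      "\<forall>i<k. Z i \<subset> Z (Suc i)" and k: "0 < enat k"
    unfolding less_Sup_iff by blast
  then have k: "0 < k"
    by (simp add: zero_enat_def)
  then have "Z 0 \<subset> Z 1" "Z 0 \<noteq> {}" "Z 1 \<subseteq> topspace (zariski_on C)"
    using Z by (auto simp: irreducible_in_def closedin_subset)
  moreover from this obtain x y where "x \<in> Z 0" "y \<in> Z 1" "y \<notin> Z 0"
    by blast
  ultimately show ?thesis
    by (intro bexI[of _ x] bexI[of _ y]) auto
qed

text \<open>
  A second point of \<open>C\<close>, removed by a separating linear form, guarantees that the neighbourhood is proper.
\<close>

lemma chart_opens_cover:
  fixes C :: "('k::finite) pt set"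
  assumes C: "C \<subseteq> proj_space" and two: "\<exists>x\<in>C. \<exists>y\<in>C. x \<noteq> y" and p: "p \<in> C"
  shows "\<exists>V\<in>chart_opens C. p \<in> V"
proof -
  obtain q where q: "q \<in> C" "p \<noteq> q"
    using two by metis
  obtain F where F: "homogeneous_form 1 F" "p \<in> nonvanishing_locus F" "q \<notin> nonvanishing_locus F"
    using separating_linear_form[of p q] C p q by blast
  obtain v where v: "v \<noteq> 0" "p = vec.span {v}"
    using C p by (auto simp: proj_space_def)
  obtain i where i: "v $ i \<noteq> 0"
    using v by (metis vec_eq_iff zero_index)
  define V where "V = (C \<inter> nonvanishing_locus (\<lambda>v. v $ i)) \<inter> (C \<inter> nonvanishing_locus F)"
  have "openin (zariski_on C) V"
    unfolding V_def
    by (intro openin_Int openin_zariski_on_nonvanishing_locus[OF homogeneous_form_coordinate]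
        openin_zariski_on_nonvanishing_locus[OF F(1)])
  moreover have "p \<in> nonvanishing_locus (\<lambda>v. v $ i)"
    using nonvanishing_locus_iff[OF homogeneous_form_coordinate v(1)] v i by simp
  ultimately show ?thesis
    using p q F by (intro bexI[of _ V]) (auto simp: chart_opens_def V_def)
qed

lemma chart_opens_subset:
  assumes "V \<in> chart_opens C" "openin (zariski_on C) W" "W \<subseteq> V"
  shows "W \<in> chart_opens C"
proof -
  have "V \<subseteq> C"
    using assms(1) openin_subset[of "zariski_on C" V] by (auto simp: chart_opens_def)
  then have "W \<noteq> C"
    using assms by (auto simp: chart_opens_def)
  then show ?thesis
    using assms unfolding chart_opens_def by blast
qed

lemma dehomogenization:
  fixes C :: "('k::finite) pt set"
  assumes V: "openin (zariski_on C) V" "V \<subseteq> nonvanishing_locus (\<lambda>v. v $ i)"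
    and F: "homogeneous_form d F"
  obtains a where "a \<in> regular_functions C V"
    "\<And>q v. q \<in> V \<Longrightarrow> v \<in> q - {0} \<Longrightarrow> a q = F v / (v $ i) ^ d"
proof
  define rep :: "'k pt \<Rightarrow> complex^'k" where "rep q = (SOME v. v \<in> q - {0})" for q
  define a where "a = (\<lambda>q\<in>V. F (rep q) / (rep q $ i) ^ d)"
  show eq: "a q = F v / (v $ i) ^ d" if q: "q \<in> V" and v: "v \<in> q - {0}" for q v
  proof -
    have w: "rep q \<in> q - {0}"
      using v unfolding rep_def by (rule someI)
    obtain u where u: "u \<noteq> 0" "q = vec.span {u}"
      using V q by (auto simp: nonvanishing_locus_def proj_space_def)
    obtain c where c: "c \<noteq> 0" "v = c *s u"
      using proj_space_member[OF u(1)] v u by metis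
    obtain c' where c': "c' \<noteq> 0" "rep q = c' *s u"
      using proj_space_member[OF u(1)] w u by metis
    show ?thesis
      using c c' q by (simp add: a_def homogeneous_form_scaling[OF F] power_mult_distrib)
  qed
  have "quotient_of_forms_on V a"
    unfolding quotient_of_forms_on_def
    using F homogeneous_form_coordinate_power[of d i] V(2) eq
    by (intro exI[of _ d] exI[of _ F] exI[of _ "\<lambda>v. (v $ i) ^ d"])
      (auto simp: nonvanishing_locus_def)
  then show "a \<in> regular_functions C V"
    using V by (auto simp: regular_functions_iff a_def)
qed

text \<open>
  A local representation \<open>F / G\<close> by forms of degree \<open>d\<close> is turned into a quotient of functions defined on
  all of \<open>V\<close> by dividing both forms by \<open>v\<^sub>i^d\<close>.
\<close>

lemma regular_function_local_fraction:
  assumes V: "V \<in> chart_opens C" and W: "openin (zariski_on C) W" "W \<subseteq> V"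
    and h: "h \<in> regular_functions C W" and p: "p \<in> W"
  obtains X a b where "openin (zariski_on C) X" "p \<in> X" "X \<subseteq> W"
    "a \<in> regular_functions C V" "b \<in> regular_functions C V"
    "\<And>q. q \<in> X \<Longrightarrow> b q \<noteq> 0" "\<And>q. q \<in> X \<Longrightarrow> h q * b q = a q"
proof -
  obtain i where i: "openin (zariski_on C) V" "V \<subseteq> nonvanishing_locus (\<lambda>v. v $ i)"
    using V by (auto simp: chart_opens_def)
  obtain X where X: "openin (zariski_on C) X" "p \<in> X" "X \<subseteq> W" "quotient_of_forms_on X h"
    using h p unfolding regular_functions_iff by blast
  then obtain d F G where FG: "homogeneous_form d F" "homogeneous_form d G"
      "\<And>q v. q \<in> X \<Longrightarrow> v \<in> q - {0} \<Longrightarrow> G v \<noteq> 0 \<and> h q = F v / G v"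
    unfolding quotient_of_forms_on_def by blast
  obtain a where a: "a \<in> regular_functions C V"
      "\<And>q v. q \<in> V \<Longrightarrow> v \<in> q - {0} \<Longrightarrow> a q = F v / (v $ i) ^ d"
    using dehomogenization[OF i FG(1)] by blast
  obtain b where b: "b \<in> regular_functions C V"
      "\<And>q v. q \<in> V \<Longrightarrow> v \<in> q - {0} \<Longrightarrow> b q = G v / (v $ i) ^ d"
    using dehomogenization[OF i FG(2)] by blast
  have "b q \<noteq> 0 \<and> h q * b q = a q" if q: "q \<in> X" for q
  proof -
    have qV: "q \<in> V"
      using q X W by blast
    then obtain v where v: "v \<noteq> 0" "q = vec.span {v}"
      using i by (auto simp: nonvanishing_locus_def proj_space_def)
    then have vq: "v \<in> q - {0}"
      using vec.span_base[of v "{v}"] by simp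
    have "v $ i \<noteq> 0"
      using i qV vq by (auto simp: nonvanishing_locus_def)
    then show ?thesis
      using a(2)[OF qV vq] b(2)[OF qV vq] FG(3)[OF q vq] by simp
  qed
  then show ?thesis
    using that[OF X(1-3) a(1) b(1)] by blast
qed

text \<open>
  If \<open>h b = a\<close> near \<open>p\<close> with \<open>a, b\<close> regular on \<open>V\<close> and \<open>b\<close> nowhere zero, then
  \<open>b D(h) = D(a) - h D(b)\<close>, and the right-hand side involves only the derivation over \<open>V\<close>.
\<close>

lemma tangent_section_determined_on_chart:
  assumes V: "V \<in> chart_opens C"
    and D: "D \<in> carrier (tangent_sheaf C V)" and E: "E \<in> carrier (tangent_sheaf C V)"
    and eq: "\<And>f. f \<in> regular_functions C V \<Longrightarrow> D V f = E V f"
  shows "D = E"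
proof (rule tangent_sheaf_eqI[OF D E])
  fix W h p assume W: "openin (zariski_on C) W" "W \<subseteq> V" and h: "h \<in> regular_functions C W" and p: "p \<in> W"
  have opV: "openin (zariski_on C) V"
    using V by (simp add: chart_opens_def)
  obtain X a b where X: "openin (zariski_on C) X" "p \<in> X" "X \<subseteq> W"
      and a: "a \<in> regular_functions C V" and b: "b \<in> regular_functions C V"
      and b0: "\<And>q. q \<in> X \<Longrightarrow> b q \<noteq> 0" and hb: "\<And>q. q \<in> X \<Longrightarrow> h q * b q = a q"
    using regular_function_local_fraction[OF V W h p] by metis
  have XV: "X \<subseteq> V"
    using X W by blast
  define h' where "h' = restrict h X"
  define b' where "b' = restrict b X"
  have h'_reg: "h' \<in> regular_functions C X" and b'_reg: "b' \<in> regular_functions C X"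
    unfolding h'_def b'_def by (rule regular_functions_restrict[OF h X(1,3)] regular_functions_restrict[OF b X(1) XV])+
  have prod: "(\<lambda>q\<in>X. h' q * b' q) = restrict a X"
    using hb by (auto simp: h'_def b'_def)
  have "b p * T W h p = T V a p - h p * T V b p" if T: "T \<in> carrier (tangent_sheaf C V)" for T
  proof -
    have "T X (\<lambda>q\<in>X. h' q * b' q) p = h' p * T X b' p + b' p * T X h' p"
      by (rule derivations_mult[OF tangent_sheaf_derivation[OF T X(1) XV] X(1) h'_reg b'_reg X(2)])
    moreover have "T X h' p = T W h p"
      unfolding h'_def by (rule tangent_sheaf_restrict[OF T W(1) X(1,3) W(2) h X(2)])
    moreover have "T X b' p = T V b p"
      unfolding b'_def by (rule tangent_sheaf_restrict[OF T opV X(1) XV subset_refl b X(2)])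
    moreover have "T X (restrict a X) p = T V a p"
      by (rule tangent_sheaf_restrict[OF T opV X(1) XV subset_refl a X(2)])
    ultimately show ?thesis
      using X(2) by (simp add: prod) (simp add: h'_def b'_def)
  qed
  from this[OF D] this[OF E] have "b p * D W h p = b p * E W h p"
    by (simp add: eq[OF a] eq[OF b])
  then show "D W h p = E W h p"
    using b0[OF X(2)] by simp
qed

section \<open>The kernel and the isomorphism\<close>

text \<open>
  Reduction modulo \<open>t^N\<close> is surjective, so the induced automorphism is the identity exactly when
  \<open>\<phi>\<close> changes no coefficient below degree \<open>N\<close>.
\<close>

lemma kernel_of_canonical_morphism:
  assumes G: "aut_sheaf C (Suc N) G r" and G': "aut_sheaf C N G' r'"
    and \<rho>: "canonical_morphism C (Suc N) G r G' r' \<rho>"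
    and U: "openin (zariski_on C) U" "U \<noteq> C"
  shows "kernel (G U) (G' U) (\<rho> U) = top_order_automorphisms C N U"
proof -
  have GU: "G U = Aut_\<A> C (Suc N) U" and G'U: "G' U = Aut_\<A> C N U"
    using aut_sheaf.sections[OF G U] aut_sheaf.sections[OF G' U] by auto
  have one: "\<one>\<^bsub>Aut_\<A> C N U\<^esub> = (\<lambda>a \<in> carrier (\<A> C N U). a)"
    by (simp add: Aut_\<A>_def BijGroup_def)
  have "\<rho> U \<phi> = \<one>\<^bsub>G' U\<^esub> \<longleftrightarrow> (\<forall>a \<in> carrier (\<A> C (Suc N) U). \<forall>i<N. \<phi> a i = a i)"
    if \<phi>: "\<phi> \<in> carrier (Aut_\<A> C (Suc N) U)" for \<phi>
  proof -
    have trunc: "\<rho> U \<phi> (\<A>_trunc N U a) = \<A>_trunc N U (\<phi> a)" if "a \<in> carrier (\<A> C (Suc N) U)" for a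
      using \<rho> U \<phi> that by (simp add: canonical_morphism_def GU)
    have "\<rho> U \<in> hom (G U) (G' U)"
      using \<rho> U by (simp add: canonical_morphism_def sheaf_hom_def)
    then have "\<rho> U \<phi> \<in> carrier (Aut_\<A> C N U)"
      using \<phi> by (auto simp: hom_def GU G'U)
    then have ext: "\<rho> U \<phi> \<in> extensional (carrier (\<A> C N U))"
      by (simp add: Aut_A_mem_iff)
    show ?thesis
    proof
      assume eq: "\<rho> U \<phi> = \<one>\<^bsub>G' U\<^esub>"
      show "\<forall>a \<in> carrier (\<A> C (Suc N) U). \<forall>i<N. \<phi> a i = a i"
      proof (intro ballI allI impI)
        fix a i assume a: "a \<in> carrier (\<A> C (Suc N) U)" and i: "i < N"
        have "\<A>_trunc N U a \<in> carrier (\<A> C N U)"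
          using a by (simp add: A_mem_iff \<A>_trunc_def)
        then have "\<A>_trunc N U (\<phi> a) = \<A>_trunc N U a"
          using trunc[OF a] by (simp add: eq G'U one)
        then have "\<A>_trunc N U (\<phi> a) i = \<A>_trunc N U a i"
          by simp
        then show "\<phi> a i = a i"
          using i by (simp add: \<A>_trunc_def)
      qed
    next
      assume low: "\<forall>a \<in> carrier (\<A> C (Suc N) U). \<forall>i<N. \<phi> a i = a i"
      show "\<rho> U \<phi> = \<one>\<^bsub>G' U\<^esub>"
        unfolding G'U one
      proof (rule extensionalityI[OF ext])
        fix b assume b: "b \<in> carrier (\<A> C N U)"
        have b': "b \<in> carrier (\<A> C (Suc N) U)"
          using b regular_functions_const[OF U(1), of 0] by (auto simp: A_mem_iff less_Suc_eq)
        have "\<A>_trunc N U b = b"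
          using b by (auto simp: A_mem_iff \<A>_trunc_def)
        moreover have "\<A>_trunc N U (\<phi> b) = \<A>_trunc N U b"
          using low b' by (auto simp: \<A>_trunc_def)
        ultimately show "\<rho> U \<phi> b = (\<lambda>a \<in> carrier (\<A> C N U). a) b"
          using trunc[OF b'] b by simp
      qed simp
    qed
  qed
  then show ?thesis
    by (auto simp: kernel_def top_order_automorphisms_def GU)
qed

theorem mainTheorem5:
  fixes C :: "('k::finite) pt set" and n :: nat
  assumes "smooth_irreducible_projective_curve C"
    and "n \<ge> 3"
    and "aut_sheaf C n G r"
    and "aut_sheaf C (n - 1) G' r'"
    and "canonical_morphism C n G r G' r' \<rho>"
  shows "sheaves_isomorphic (zariski_on C)
           (kernel_sheaf G G' \<rho>) r
           (tangent_plus_structure_sheaf C) (tangent_plus_structure_restrict C)"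
proof -
  obtain N where n: "n = Suc N" and N: "2 \<le> N"
    using assms(2) by (cases n) auto
  have G: "aut_sheaf C (Suc N) G r" and G': "aut_sheaf C N G' r'"
    and \<rho>: "canonical_morphism C (Suc N) G r G' r' \<rho>"
    using assms(3-5) by (simp_all add: n)
  have C_top: "C \<subseteq> topspace zariski"
    using smooth_irreducible_projective_curve.closed_in_proj_space[OF assms(1)] by (rule closedin_subset)
  then have C_proj: "C \<subseteq> proj_space"
    using topspace_zariski_subset by blast
  have two: "\<exists>x\<in>C. \<exists>y\<in>C. x \<noteq> y"
    by (rule two_points_if_dimension_one[OF smooth_irreducible_projective_curve.dimension_one[OF assms(1)]])
  let ?K = "kernel_sheaf G G' \<rho>" and ?T = "zariski_on C" and ?A = "\<A> C (Suc N)"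
  have K_sheaf: "sheaf_of_groups ?T ?K r"
  proof (rule kernel_sheaf_is_sheaf)
    show "sheaf_of_groups ?T G r" "sheaf_of_groups ?T G' r'"
      using G G' by (simp_all add: aut_sheaf_def)
    show "sheaf_hom ?T G r G' r' \<rho>"
      using \<rho> by (simp add: canonical_morphism_def)
  qed
  interpret K: sheaf_of_groups ?T ?K r
    by (rule K_sheaf)
  have proper: "W \<noteq> C" if "openin ?T V" "V \<noteq> C" "W \<subseteq> V" for V W
    using openin_subset[OF that(1)] that by auto
  have K_carrier: "carrier (?K V) = top_order_automorphisms C N V" if "openin ?T V" "V \<noteq> C" for V
    using kernel_of_canonical_morphism[OF G G' \<rho> that] by (simp add: kernel_sheaf_def)
  have K_mult: "\<phi> \<otimes>\<^bsub>?K V\<^esub> \<psi> = \<phi> \<otimes>\<^bsub>Aut_\<A> C (Suc N) V\<^esub> \<psi>" if "openin ?T V" "V \<noteq> C" for V \<phi> \<psi>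
    using aut_sheaf.sections[OF G that] by (simp add: kernel_sheaf_def)
  have K_restrict: "r V W \<phi> (\<A>_restrict W a) = \<A>_restrict W (\<phi> a)"
    if "openin ?T V" "V \<noteq> C" "openin ?T W" "W \<subseteq> V" "\<phi> \<in> carrier (?K V)" "a \<in> carrier (?A V)" for V W \<phi> a
    using aut_sheaf.restriction[OF G that(1-4) _ that(6), of \<phi>] that(5)
    by (simp add: kernel_sheaf_def kernel_def)
  have const_restrict: "\<A>_restrict W (constant_coeffs V h) = constant_coeffs W (restrict h W)"
    if "W \<subseteq> V" for V W :: "'k pt set" and h
    using that by (auto simp: \<A>_restrict_def constant_coeffs_def fun_eq_iff)
  have t_restrict: "\<A>_restrict W (t_coeffs V) = t_coeffs W" if "W \<subseteq> V" for V W :: "'k pt set"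
    using that by (auto simp: \<A>_restrict_def t_coeffs_def fun_eq_iff)
  \<comment> \<open>The derivation over a smaller open set \<open>W\<close> is read off from the restriction of \<open>\<phi>\<close> to \<open>W\<close>; it is not
      computed from the derivation over \<open>V\<close>.\<close>
  define \<delta> where "\<delta> V \<phi> = (\<lambda>W \<in> opens_within C V. \<lambda>h \<in> regular_functions C W.
      r V W \<phi> (constant_coeffs W h) N)" for V \<phi>
  define \<theta> where "\<theta> V \<phi> = (\<delta> V \<phi>, \<phi> (t_coeffs V) N)" for V \<phi>
  have K_restrict_mem: "r V W \<phi> \<in> top_order_automorphisms C N W"
    if "openin ?T V" "V \<noteq> C" "openin ?T W" "W \<subseteq> V" "\<phi> \<in> carrier (?K V)" for V W \<phi>
    using K.restriction_closed[OF that(1,3-5)] K_carrier[OF that(3) proper[OF that(1,2,4)]] by simp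
  have \<delta>_closed: "\<delta> V \<phi> \<in> carrier (tangent_sheaf C V)"
    if V: "openin ?T V" "V \<noteq> C" and \<phi>: "\<phi> \<in> carrier (?K V)" for V \<phi>
  proof (rule tangent_sheafI)
    show "\<delta> V \<phi> \<in> extensional (opens_within C V)"
      by (simp add: \<delta>_def)
  next
    fix W assume W: "openin ?T W" "W \<subseteq> V"
    then show "\<delta> V \<phi> W \<in> derivations C W"
      using top_order_derivation[OF W(1) N K_restrict_mem[OF V W \<phi>]] by (simp add: \<delta>_def)
  next
    fix W X h p
    assume W: "openin ?T W" "W \<subseteq> V" and X: "openin ?T X" "X \<subseteq> W"
      and h: "h \<in> regular_functions C W" and p: "p \<in> X"
    have XV: "X \<subseteq> V"
      using W X by blast
    have "r V X \<phi> (constant_coeffs X (restrict h X)) = r W X (r V W \<phi>) (\<A>_restrict X (constant_coeffs W h))"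
      using K.restriction_trans[OF V(1) W(1) X W(2) \<phi>] const_restrict[OF X(2)] by simp
    also have "\<dots> = \<A>_restrict X (r V W \<phi> (constant_coeffs W h))"
      by (rule K_restrict[OF W(1) proper[OF V W(2)] X K.restriction_closed[OF V(1) W \<phi>]
            constant_coeffs_closed[OF W(1) N h]])
    finally show "\<delta> V \<phi> X (restrict h X) p = \<delta> V \<phi> W h p"
      using W X XV h p regular_functions_restrict[OF h X] by (simp add: \<delta>_def \<A>_restrict_def)
  qed
  show ?thesis
  proof (rule sheaves_isomorphic_if_iso_on_basis[where B = "chart_opens C" and \<theta> = \<theta>])
    show "sheaf_of_groups ?T ?K r"
      by (rule K_sheaf)
    show "sheaf_of_groups ?T (tangent_plus_structure_sheaf C) (tangent_plus_structure_restrict C)"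
      by (rule tangent_plus_structure_sheaf_is_sheaf)
    show "openin ?T V" if "V \<in> chart_opens C" for V
      using that by (simp add: chart_opens_def)
    show "W \<in> chart_opens C" if "V \<in> chart_opens C" "openin ?T W" "W \<subseteq> V" for V W
      using that by (rule chart_opens_subset)
    show "\<exists>V\<in>chart_opens C. p \<in> V" if "p \<in> topspace ?T" for p
      using chart_opens_cover[OF C_proj two] that by simp
  next
    fix V W \<phi>
    assume V': "V \<in> chart_opens C" and W: "openin ?T W" "W \<subseteq> V" and \<phi>: "\<phi> \<in> carrier (?K V)"
    have V: "openin ?T V" "V \<noteq> C"
      using V' by (simp_all add: chart_opens_def)
    have "\<delta> W (r V W \<phi>) = restrict (\<delta> V \<phi>) (opens_within C W)"
      by (rule extensionalityI[of _ "opens_within C W"])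
        (use W V \<phi> K.restriction_trans[OF V(1) W(1)] in \<open>auto simp: \<delta>_def\<close>)
    moreover have "r V W \<phi> (t_coeffs W) N = restrict (\<phi> (t_coeffs V) N) W"
      using K_restrict[OF V W \<phi> t_coeffs_closed[OF V(1) N]] t_restrict[OF W(2)]
      by (simp add: \<A>_restrict_def)
    ultimately show "\<theta> W (r V W \<phi>) = tangent_plus_structure_restrict C V W (\<theta> V \<phi>)"
      by (simp add: \<theta>_def tangent_plus_structure_restrict_def)
  next
    fix V assume V': "V \<in> chart_opens C"
    then have V: "openin ?T V" "V \<noteq> C"
      by (simp_all add: chart_opens_def)
    have carrier_V: "carrier (?K V) = top_order_automorphisms C N V"
      by (rule K_carrier[OF V])
    have rVV: "r V V \<phi> = \<phi>" if "\<phi> \<in> carrier (?K V)" for \<phi>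
      using K.restriction_id[OF V(1) that] .
    have \<delta>_V: "\<delta> V \<phi> V h = \<phi> (constant_coeffs V h) N"
      if "\<phi> \<in> carrier (?K V)" "h \<in> regular_functions C V" for \<phi> h
      using that V rVV by (simp add: \<delta>_def)
    have \<theta>_closed: "\<theta> V \<phi> \<in> carrier (tangent_plus_structure_sheaf C V)" if \<phi>: "\<phi> \<in> carrier (?K V)" for \<phi>
      using \<delta>_closed[OF V \<phi>] A_coeff_regular[OF V(1) N top_order_closed[OF V(1) N _ t_coeffs_closed[OF V(1) N]]] \<phi>
      by (simp add: \<theta>_def tangent_plus_structure_sheaf_def carrier_V)
    have \<theta>_mult: "\<theta> V (\<phi> \<otimes>\<^bsub>?K V\<^esub> \<psi>) = \<theta> V \<phi> \<otimes>\<^bsub>tangent_plus_structure_sheaf C V\<^esub> \<theta> V \<psi>"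
      if \<phi>: "\<phi> \<in> carrier (?K V)" and \<psi>: "\<psi> \<in> carrier (?K V)" for \<phi> \<psi>
    proof -
      have \<phi>\<psi>: "\<phi> \<otimes>\<^bsub>?K V\<^esub> \<psi> \<in> carrier (?K V)"
        by (rule K.mult_closed[OF V(1) \<phi> \<psi>])
      have "\<delta> V (\<phi> \<otimes>\<^bsub>?K V\<^esub> \<psi>) = \<delta> V \<phi> \<otimes>\<^bsub>tangent_sheaf C V\<^esub> \<delta> V \<psi>"
      proof (rule tangent_sheaf_eqI[OF \<delta>_closed[OF V \<phi>\<psi>]
            tangent_sheaf_mult_closed[OF \<delta>_closed[OF V \<phi>] \<delta>_closed[OF V \<psi>]]])
        fix W h p assume W: "openin ?T W" "W \<subseteq> V" and h: "h \<in> regular_functions C W" and p: "p \<in> W"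
        have "r V W (\<phi> \<otimes>\<^bsub>?K V\<^esub> \<psi>) = r V W \<phi> \<otimes>\<^bsub>Aut_\<A> C (Suc N) W\<^esub> r V W \<psi>"
          using K.restriction_mult[OF V(1) W \<phi> \<psi>] K_mult[OF W(1) proper[OF V W(2)]] by simp
        then have "r V W (\<phi> \<otimes>\<^bsub>?K V\<^esub> \<psi>) (constant_coeffs W h) N p
            = r V W \<phi> (constant_coeffs W h) N p + r V W \<psi> (constant_coeffs W h) N p"
          using top_order_compose[OF W(1) N K_restrict_mem[OF V W \<phi>] K_restrict_mem[OF V W \<psi>]
              constant_coeffs_closed[OF W(1) N h] p] p
          by (simp add: constant_coeffs_def)
        then show "\<delta> V (\<phi> \<otimes>\<^bsub>?K V\<^esub> \<psi>) W h p = (\<delta> V \<phi> \<otimes>\<^bsub>tangent_sheaf C V\<^esub> \<delta> V \<psi>) W h p"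
          using W h p by (simp add: tangent_sheaf_mult \<delta>_def)
      qed
      moreover have "(\<phi> \<otimes>\<^bsub>?K V\<^esub> \<psi>) (t_coeffs V) N
          = \<phi> (t_coeffs V) N \<oplus>\<^bsub>\<O> C V\<^esub> \<psi> (t_coeffs V) N"
      proof (rule extensionalityI[of _ V])
        show "(\<phi> \<otimes>\<^bsub>?K V\<^esub> \<psi>) (t_coeffs V) N \<in> extensional V"
          using \<phi>\<psi> unfolding carrier_V
          by (rule A_coeff_extensional[OF V(1) N top_order_closed[OF V(1) N _ t_coeffs_closed[OF V(1) N]]])
        fix p assume p: "p \<in> V"
        \<comment> \<open>A derivation kills the constant coefficient of \<open>t\<close>, which is 0, because \<open>0 = 0 * 0\<close> and \<open>D\<close> is linear.\<close>
        have t0: "t_coeffs V 0 = (\<lambda>p\<in>V. 0 * (\<lambda>p\<in>V. 0) p)"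
          by (auto simp: t_coeffs_def)
        have "(\<lambda>h \<in> regular_functions C V. \<phi> (constant_coeffs V h) N) (t_coeffs V 0) p = 0"
          unfolding t0 using \<phi> derivations_scale[OF top_order_derivation[OF V(1) N, of \<phi>] V(1)
              regular_functions_const[OF V(1), of 0] p, of 0]
          by (simp add: carrier_V)
        then have "\<phi> (constant_coeffs V (t_coeffs V 0)) N p = 0"
          using A_coeff_regular[OF V(1) N t_coeffs_closed[OF V(1) N]] by simp
        moreover have "t_coeffs V 1 p = 1"
          using p by (simp add: t_coeffs_def)
        ultimately show "(\<phi> \<otimes>\<^bsub>?K V\<^esub> \<psi>) (t_coeffs V) N p
            = (\<phi> (t_coeffs V) N \<oplus>\<^bsub>\<O> C V\<^esub> \<psi> (t_coeffs V) N) p"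
          using \<phi> \<psi> p top_order_compose[OF V(1) N _ _ t_coeffs_closed[OF V(1) N] p, of \<phi> \<psi>]
          by (simp add: K_mult[OF V] carrier_V)
      qed simp
      ultimately show ?thesis
        by (simp add: \<theta>_def tangent_plus_structure_sheaf_def)
    qed
    have \<theta>_inj: "inj_on (\<theta> V) (carrier (?K V))"
    proof (rule inj_onI)
      fix \<phi> \<psi> assume \<phi>: "\<phi> \<in> carrier (?K V)" and \<psi>: "\<psi> \<in> carrier (?K V)" and eq: "\<theta> V \<phi> = \<theta> V \<psi>"
      have "\<delta> V \<phi> = \<delta> V \<psi>" "\<phi> (t_coeffs V) N = \<psi> (t_coeffs V) N"
        using eq by (simp_all add: \<theta>_def)
      then show "\<phi> = \<psi>"
        using \<phi> \<psi> \<delta>_V[OF \<phi>] \<delta>_V[OF \<psi>]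
        by (intro top_order_eqI[OF V(1) N]) (simp_all add: carrier_V)
    qed
    have \<theta>_surj: "x \<in> \<theta> V ` carrier (?K V)" if x: "x \<in> carrier (tangent_plus_structure_sheaf C V)" for x
    proof -
      obtain D g where x_eq: "x = (D, g)"
        by (cases x)
      have D: "D \<in> carrier (tangent_sheaf C V)" and g: "g \<in> regular_functions C V"
        using x by (simp_all add: x_eq tangent_plus_structure_sheaf_def)
      have DV: "D V \<in> derivations C V"
        by (rule tangent_sheaf_derivation[OF D V(1) subset_refl])
      let ?\<phi> = "top_order_map C N V (D V) g"
      have \<phi>: "?\<phi> \<in> carrier (?K V)"
        unfolding carrier_V by (rule top_order_map_in[OF V(1) N DV g])
      have "\<delta> V ?\<phi> = D"
      proof (rule tangent_section_determined_on_chart[OF V' \<delta>_closed[OF V \<phi>] D])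
        fix h assume h: "h \<in> regular_functions C V"
        show "\<delta> V ?\<phi> V h = D V h"
          using \<delta>_V[OF \<phi> h] top_order_map_constant[OF V(1) N DV g h] by simp
      qed
      then have "\<theta> V ?\<phi> = x"
        by (simp add: \<theta>_def x_eq top_order_map_t[OF V(1) N DV g])
      then show ?thesis
        using \<phi> by blast
    qed
    have "\<theta> V \<in> hom (?K V) (tangent_plus_structure_sheaf C V)"
      by (intro homI \<theta>_closed \<theta>_mult)
    moreover have "\<theta> V ` carrier (?K V) = carrier (tangent_plus_structure_sheaf C V)"
      using \<theta>_closed \<theta>_surj by (intro equalityI subsetI) auto
    ultimately show "\<theta> V \<in> iso (?K V) (tangent_plus_structure_sheaf C V)"
      using \<theta>_inj by (simp add: iso_def bij_betw_def)
  qed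
qed

end
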